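(* Let $(G,P)$ be a quasi-lattice ordered group with subgroups $A$ and $B$. Suppose that: (1) there is an isomorphism $\phi:A\to B$ such that $\phi(A\cap P)=B\cap P$; (2) every left coset $gA\in G/A$ such that $gA\cap P\neq\emptyset$ has a minimal coset representative $p\in P$, that is, there is $p\in gA\cap P$ such that $q\in gA\cap P\Rightarrow p\le q$; (3) for every $x,y\in B$, $x\vee y<\infty\Rightarrow x\vee y\in B$. Let $G^*=\langle G,t\mid t^{-1}at=\phi(a),\ a\in A\rangle$ be the HNN extension of $G$ and let $P^*$ be the subsemigroup of $G^*$ generated by $P\cup\{t\}$. Then $(G^*,P^* )$ is quasi-lattice ordered.
   Context: $e$ denotes the identity of any group. Let $P$ be a subsemigroup of a discrete group $G$ with $P\cap P^{-1}=\{e\}$. Define a left-invariant partial order on $G$ by $x\le y\iff x^{-1}y\in P$. The pair $(G,P)$ is quasi-lattice ordered if every finite subset of $G$ with a common upper bound in $P$ has a least common upper bound in $P$. For $x,y\in G$, if $x,y$ have a common upper bound in $P$ we write $x\vee y<\infty$ and let $x\vee y\in P$ denote their least common upper bound in $P$; otherwise $x\vee y=\infty$. *)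

theory Defs
  imports "HOL-Algebra.Group" "HOL-Algebra.Coset"
begin

section \<open>Quasi-lattice ordered groups\<close>

definition cone_le :: "('a, 'm) monoid_scheme \<Rightarrow> 'a set \<Rightarrow> 'a \<Rightarrow> 'a \<Rightarrow> bool" where
  "cone_le G P x y \<longleftrightarrow> inv\<^bsub>G\<^esub> x \<otimes>\<^bsub>G\<^esub> y \<in> P"

definition upper_bound_in :: "('a, 'm) monoid_scheme \<Rightarrow> 'a set \<Rightarrow> 'a set \<Rightarrow> 'a \<Rightarrow> bool" where
  "upper_bound_in G P F u \<longleftrightarrow> u \<in> P \<and> (\<forall>x\<in>F. cone_le G P x u)"

definition lub_in :: "('a, 'm) monoid_scheme \<Rightarrow> 'a set \<Rightarrow> 'a set \<Rightarrow> 'a \<Rightarrow> bool" where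
  "lub_in G P F u \<longleftrightarrow>
     upper_bound_in G P F u \<and> (\<forall>v. upper_bound_in G P F v \<longrightarrow> cone_le G P u v)"

locale quasi_lattice_ordered = group G for G (structure) +
  fixes P :: "'a set"
  assumes cone_subset: "P \<subseteq> carrier G"
    and cone_closed: "\<lbrakk>x \<in> P; y \<in> P\<rbrakk> \<Longrightarrow> x \<otimes> y \<in> P"
    and cone_pointed: "P \<inter> set_inv P = {\<one>}"
    and lub_exists:
      "\<lbrakk>finite F; F \<subseteq> carrier G; \<exists>u. upper_bound_in G P F u\<rbrakk> \<Longrightarrow> \<exists>u. lub_in G P F u"

definition join_finite :: "('a, 'm) monoid_scheme \<Rightarrow> 'a set \<Rightarrow> 'a \<Rightarrow> 'a \<Rightarrow> bool" where
  "join_finite G P x y \<longleftrightarrow> (\<exists>u. upper_bound_in G P {x, y} u)"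

text \<open>Only meaningful when \<^const>\<open>join_finite\<close> holds.\<close>

definition join :: "('a, 'm) monoid_scheme \<Rightarrow> 'a set \<Rightarrow> 'a \<Rightarrow> 'a \<Rightarrow> 'a" where
  "join G P x y = (THE u. lub_in G P {x, y} u)"

lemma (in quasi_lattice_ordered) lub_in_unique:
  assumes "F \<subseteq> carrier G" "lub_in G P F u" "lub_in G P F v"
  shows "u = v"
proof -
  have u: "u \<in> P" "u \<in> carrier G" and v: "v \<in> P" "v \<in> carrier G"
    using assms cone_subset by (auto simp: lub_in_def upper_bound_in_def)
  have uv: "inv u \<otimes> v \<in> P" and vu: "inv v \<otimes> u \<in> P"
    using assms by (auto simp: lub_in_def cone_le_def)
  have "inv u \<otimes> v = inv (inv v \<otimes> u)"
    using u v by (simp add: inv_mult_group)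
  then have "inv u \<otimes> v \<in> set_inv P"
    using vu by (auto simp: SET_INV_def)
  then have "inv u \<otimes> v = \<one>"
    using uv cone_pointed by blast
  then show ?thesis
    using u v by (metis inv_equality inv_inv inv_closed)
qed

lemma (in quasi_lattice_ordered) join_is_lub:
  assumes "x \<in> carrier G" "y \<in> carrier G" "join_finite G P x y"
  shows "lub_in G P {x, y} (join G P x y)"
proof -
  have "\<exists>u. lub_in G P {x, y} u"
    using assms lub_exists[of "{x, y}"] by (auto simp: join_finite_def)
  then show ?thesis
    unfolding join_def using assms lub_in_unique[of "{x, y}"] by (auto intro: theI)
qed

inductive_set generated_subsemigroup ::
  "('a, 'm) monoid_scheme \<Rightarrow> 'a set \<Rightarrow> 'a set" for G S where
  incl: "x \<in> S \<Longrightarrow> x \<in> generated_subsemigroup G S"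
| mult: "\<lbrakk>x \<in> generated_subsemigroup G S; y \<in> generated_subsemigroup G S\<rbrakk>
    \<Longrightarrow> x \<otimes>\<^bsub>G\<^esub> y \<in> generated_subsemigroup G S"

section \<open>HNN extensions\<close>

text \<open>
  The group presented by the generators of \<open>G\<close> together with a stable letter \<open>t\<close> is realised as
  words in the elements of \<open>G\<close>, \<open>t\<close> and a formal inverse of \<open>t\<close>, modulo the smallest congruence
  containing the multiplication table of \<open>G\<close>, the cancellation of \<open>t\<close> against its inverse, and
  \<open>t\<inverse> a t = \<phi> a\<close> for \<open>a \<in> A\<close>.  Elements of \<open>G\<close> need no formal inverses, because the
  multiplication table already makes them invertible.  Only the values of \<open>\<phi>\<close> on \<open>A\<close> matter.
\<close>

datatype 'a hnn_letter = Base 'a | Stable | Stable_inv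

definition hnn_words :: "('a, 'm) monoid_scheme \<Rightarrow> 'a hnn_letter list set" where
  "hnn_words G = lists (Base ` carrier G \<union> {Stable, Stable_inv})"

definition hnn_relators ::
  "('a, 'm) monoid_scheme \<Rightarrow> 'a set \<Rightarrow> ('a \<Rightarrow> 'a) \<Rightarrow> ('a hnn_letter list \<times> 'a hnn_letter list) set"
  where
  "hnn_relators G A \<phi> =
     {([Base g, Base h], [Base (g \<otimes>\<^bsub>G\<^esub> h)]) | g h. g \<in> carrier G \<and> h \<in> carrier G}
   \<union> {([Base \<one>\<^bsub>G\<^esub>], []), ([Stable, Stable_inv], []), ([Stable_inv, Stable], [])}
   \<union> {([Stable_inv, Base a, Stable], [Base (\<phi> a)]) | a. a \<in> A}"

inductive_set hnn_cong ::
  "('a, 'm) monoid_scheme \<Rightarrow> 'a set \<Rightarrow> ('a \<Rightarrow> 'a) \<Rightarrow> ('a hnn_letter list \<times> 'a hnn_letter list) set"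
  for G A \<phi> where
  relator: "\<lbrakk>(l, r) \<in> hnn_relators G A \<phi>; u \<in> hnn_words G; v \<in> hnn_words G\<rbrakk>
    \<Longrightarrow> (u @ l @ v, u @ r @ v) \<in> hnn_cong G A \<phi>"
| refl: "w \<in> hnn_words G \<Longrightarrow> (w, w) \<in> hnn_cong G A \<phi>"
| sym: "(v, w) \<in> hnn_cong G A \<phi> \<Longrightarrow> (w, v) \<in> hnn_cong G A \<phi>"
| trans: "\<lbrakk>(u, v) \<in> hnn_cong G A \<phi>; (v, w) \<in> hnn_cong G A \<phi>\<rbrakk> \<Longrightarrow> (u, w) \<in> hnn_cong G A \<phi>"

definition hnn_class ::
  "('a, 'm) monoid_scheme \<Rightarrow> 'a set \<Rightarrow> ('a \<Rightarrow> 'a) \<Rightarrow> 'a hnn_letter list \<Rightarrow> 'a hnn_letter list set"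
  where "hnn_class G A \<phi> w = hnn_cong G A \<phi> `` {w}"

definition HNN ::
  "('a, 'm) monoid_scheme \<Rightarrow> 'a set \<Rightarrow> ('a \<Rightarrow> 'a) \<Rightarrow> 'a hnn_letter list set monoid" where
  "HNN G A \<phi> =
     \<lparr>carrier = hnn_words G // hnn_cong G A \<phi>,
      mult = (\<lambda>X Y. \<Union>x\<in>X. \<Union>y\<in>Y. hnn_class G A \<phi> (x @ y)),
      one = hnn_class G A \<phi> []\<rparr>"

definition hnn_base ::
  "('a, 'm) monoid_scheme \<Rightarrow> 'a set \<Rightarrow> ('a \<Rightarrow> 'a) \<Rightarrow> 'a \<Rightarrow> 'a hnn_letter list set" where
  "hnn_base G A \<phi> g = hnn_class G A \<phi> [Base g]"

definition hnn_stable ::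
  "('a, 'm) monoid_scheme \<Rightarrow> 'a set \<Rightarrow> ('a \<Rightarrow> 'a) \<Rightarrow> 'a hnn_letter list set" where
  "hnn_stable G A \<phi> = hnn_class G A \<phi> [Stable]"

locale hnn_data = group G for G (structure) +
  fixes A :: "'a set" and \<phi> :: "'a \<Rightarrow> 'a"
  assumes assoc_subset: "A \<subseteq> carrier G" and assoc_map: "\<phi> \<in> A \<rightarrow> carrier G"
begin

abbreviation "cl \<equiv> hnn_class G A \<phi>"
abbreviation "H \<equiv> HNN G A \<phi>"
abbreviation "W \<equiv> hnn_words G"

lemma hnn_words_simps [simp]:
  "[] \<in> W" "Base g # w \<in> W \<longleftrightarrow> g \<in> carrier G \<and> w \<in> W"
  "Stable # w \<in> W \<longleftrightarrow> w \<in> W" "Stable_inv # w \<in> W \<longleftrightarrow> w \<in> W"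
  "u @ v \<in> W \<longleftrightarrow> u \<in> W \<and> v \<in> W"
  by (auto simp: hnn_words_def)

lemma relators_words: "(l, r) \<in> hnn_relators G A \<phi> \<Longrightarrow> l \<in> W \<and> r \<in> W"
  using assoc_subset assoc_map by (auto simp: hnn_relators_def)

lemma cong_words: "(u, v) \<in> hnn_cong G A \<phi> \<Longrightarrow> u \<in> W \<and> v \<in> W"
  by (induction rule: hnn_cong.induct) (auto dest: relators_words)

lemma cong_equiv: "equiv W (hnn_cong G A \<phi>)"
  by (rule equivI)
    (auto simp: refl_on_def sym_def trans_def dest: cong_words
      intro: hnn_cong.refl hnn_cong.sym hnn_cong.trans)

lemma cong_context:
  "(u, v) \<in> hnn_cong G A \<phi> \<Longrightarrow> p \<in> W \<Longrightarrow> q \<in> W \<Longrightarrow> (p @ u @ q, p @ v @ q) \<in> hnn_cong G A \<phi>"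
proof (induction rule: hnn_cong.induct)
  case (relator l r u v)
  then show ?case
    using hnn_cong.relator[of l r G A \<phi> "p @ u" "v @ q"] by simp
qed (auto intro: hnn_cong.refl hnn_cong.sym hnn_cong.trans)

lemma cong_append:
  assumes "(u, u') \<in> hnn_cong G A \<phi>" "(v, v') \<in> hnn_cong G A \<phi>"
  shows "(u @ v, u' @ v') \<in> hnn_cong G A \<phi>"
  using cong_context[OF assms(1), of "[]" v] cong_context[OF assms(2), of u' "[]"]
    cong_words[OF assms(1)] cong_words[OF assms(2)]
  by (auto intro: hnn_cong.trans)

lemma class_eq_iff: "u \<in> W \<Longrightarrow> v \<in> W \<Longrightarrow> cl u = cl v \<longleftrightarrow> (u, v) \<in> hnn_cong G A \<phi>"
  unfolding hnn_class_def using cong_equiv by (rule eq_equiv_class_iff)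

lemma carrier_H: "carrier H = cl ` W"
  by (auto simp: HNN_def quotient_def hnn_class_def)

lemma one_H: "\<one>\<^bsub>H\<^esub> = cl []"
  by (simp add: HNN_def)

lemma mult_H:
  assumes "u \<in> W" "v \<in> W"
  shows "cl u \<otimes>\<^bsub>H\<^esub> cl v = cl (u @ v)"
proof -
  have "cl (x @ y) = cl (u @ v)" if "x \<in> cl u" "y \<in> cl v" for x y
    using that assms cong_append[of u x v y] cong_words[of u x] cong_words[of v y]
    by (subst class_eq_iff) (auto simp: hnn_class_def intro: hnn_cong.sym)
  moreover have "u \<in> cl u" "v \<in> cl v"
    using assms by (auto simp: hnn_class_def intro: hnn_cong.refl)
  ultimately have "(\<Union>x\<in>cl u. \<Union>y\<in>cl v. cl (x @ y)) = cl (u @ v)"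
    by blast
  then show ?thesis by (simp add: HNN_def)
qed

lemma class_relator: "(l, r) \<in> hnn_relators G A \<phi> \<Longrightarrow> cl l = cl r"
  using hnn_cong.relator[of l r G A \<phi> "[]" "[]"] relators_words[of l r]
  by (simp add: class_eq_iff)

lemma left_inverse_word: "w \<in> W \<Longrightarrow> \<exists>w'\<in>W. cl (w' @ w) = cl []"
proof (induction w)
  case Nil
  then show ?case by (intro bexI[of _ "[]"]) auto
next
  case (Cons x w)
  then have w: "w \<in> W" by (cases x) auto
  then obtain w' where w': "w' \<in> W" "cl (w' @ w) = cl []"
    using Cons.IH by blast
  have "\<exists>x'. [x'] \<in> W \<and> cl [x', x] = cl []"
  proof (cases x)
    case (Base g)
    then have g: "g \<in> carrier G" using Cons.prems by simp
    have "cl [Base (inv g), Base g] = cl [Base (inv g \<otimes> g)]"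
      using g by (intro class_relator) (auto simp: hnn_relators_def)
    also have "\<dots> = cl []"
      using g by (intro class_relator) (auto simp: hnn_relators_def)
    finally show ?thesis using g Base by (intro exI[of _ "Base (inv g)"]) simp
  next
    case Stable
    then show ?thesis
      by (intro exI[of _ Stable_inv]) (auto intro!: class_relator simp: hnn_relators_def)
  next
    case Stable_inv
    then show ?thesis
      by (intro exI[of _ Stable]) (auto intro!: class_relator simp: hnn_relators_def)
  qed
  then obtain x' where x': "[x'] \<in> W" "cl [x', x] = cl []" by blast
  have xx: "[x', x] \<in> W" using x' Cons.prems by (cases x; cases x') auto
  have "cl ((w' @ [x']) @ x # w) = cl (w' @ w)"
    using cong_context[of "[x', x]" "[]" w' w] x' xx w w'(1) class_eq_iff[of "[x', x]" "[]"]
      class_eq_iff[of "w' @ [x', x] @ w" "w' @ w"]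
    by (metis append.assoc append_Cons append_Nil hnn_words_simps(1,5))
  then show ?case
    using w' x' by (intro bexI[of _ "w' @ [x']"]) auto
qed

lemma group_HNN: "group H"
proof (rule groupI)
  fix x assume "x \<in> carrier H"
  then show "\<exists>y\<in>carrier H. y \<otimes>\<^bsub>H\<^esub> x = \<one>\<^bsub>H\<^esub>"
    using left_inverse_word by (auto simp: carrier_H one_H mult_H)
qed (auto simp: carrier_H one_H mult_H)

lemma hnn_base_hom: "hnn_base G A \<phi> \<in> hom G H"
  by (auto simp: hom_def carrier_H hnn_base_def mult_H hnn_relators_def
      intro!: class_relator[symmetric])

lemma hnn_stable_closed: "hnn_stable G A \<phi> \<in> carrier H"
  by (auto simp: hnn_stable_def carrier_H)

lemma inv_hnn_stable: "inv\<^bsub>H\<^esub> (hnn_stable G A \<phi>) = cl [Stable_inv]"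
  by (rule group.inv_equality[OF group_HNN])
    (auto simp: hnn_stable_def carrier_H one_H mult_H hnn_relators_def intro!: class_relator)

lemma hnn_relation:
  assumes "a \<in> A"
  shows "inv\<^bsub>H\<^esub> (hnn_stable G A \<phi>) \<otimes>\<^bsub>H\<^esub> hnn_base G A \<phi> a \<otimes>\<^bsub>H\<^esub> hnn_stable G A \<phi>
    = hnn_base G A \<phi> (\<phi> a)"
proof -
  have a: "a \<in> carrier G" using assms assoc_subset by blast
  have "cl [Stable_inv, Base a, Stable] = cl [Base (\<phi> a)]"
    using assms by (intro class_relator) (auto simp: hnn_relators_def)
  then show ?thesis
    unfolding inv_hnn_stable using a by (simp add: hnn_stable_def hnn_base_def mult_H)
qed

lemma HNN_universal:
  fixes K :: "('b, 'n) monoid_scheme"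
  assumes K: "group K" and f: "f \<in> hom G K" and s: "s \<in> carrier K"
    and rel: "\<And>a. a \<in> A \<Longrightarrow> inv\<^bsub>K\<^esub> s \<otimes>\<^bsub>K\<^esub> f a \<otimes>\<^bsub>K\<^esub> s = f (\<phi> a)"
  shows "\<exists>F. F \<in> hom H K \<and> (\<forall>g\<in>carrier G. F (hnn_base G A \<phi> g) = f g)
    \<and> F (hnn_stable G A \<phi>) = s"
proof -
  interpret K: group K by (rule K)
  define ev1 where "ev1 x = (case x of Base g \<Rightarrow> f g | Stable \<Rightarrow> s | Stable_inv \<Rightarrow> inv\<^bsub>K\<^esub> s)" for x
  define ev where "ev w = foldr (\<lambda>x k. ev1 x \<otimes>\<^bsub>K\<^esub> k) w \<one>\<^bsub>K\<^esub>" for w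
  have fc: "f g \<in> carrier K" if "g \<in> carrier G" for g
    using f that by (auto simp: hom_def)
  have f1: "f \<one> = \<one>\<^bsub>K\<^esub>"
    using hom_one[OF f is_group K] .
  have ev_simps [simp]: "ev [] = \<one>\<^bsub>K\<^esub>" "\<And>x w. ev (x # w) = ev1 x \<otimes>\<^bsub>K\<^esub> ev w"
    by (simp_all add: ev_def)
  have ev1_simps [simp]: "\<And>g. ev1 (Base g) = f g" "ev1 Stable = s" "ev1 Stable_inv = inv\<^bsub>K\<^esub> s"
    by (simp_all add: ev1_def)
  have ev1_closed: "ev1 x \<in> carrier K" if "x # w \<in> W" for x w
    using that fc s by (cases x) auto
  have W_tl: "w \<in> W" if "x # w \<in> W" for x w
    using that by (cases x) auto
  have ev_closed: "w \<in> W \<Longrightarrow> ev w \<in> carrier K" for w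
    by (induction w) (auto dest: ev1_closed W_tl)
  have ev_append: "u \<in> W \<Longrightarrow> v \<in> W \<Longrightarrow> ev (u @ v) = ev u \<otimes>\<^bsub>K\<^esub> ev v" for u v
  proof (induction u)
    case (Cons x u)
    then have "u \<in> W" "ev1 x \<in> carrier K" by (auto dest: W_tl ev1_closed)
    then show ?case using Cons by (simp add: K.m_assoc ev_closed)
  qed (simp add: ev_closed)
  have ev_rel: "ev l = ev r" if "(l, r) \<in> hnn_relators G A \<phi>" for l r
    using that f f1 fc s rel assoc_subset assoc_map
    by (auto simp: hnn_relators_def hom_mult[OF f] K.m_assoc subset_iff Pi_iff)
  have ev_cong: "(u, v) \<in> hnn_cong G A \<phi> \<Longrightarrow> ev u = ev v" for u v
  proof (induction rule: hnn_cong.induct)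
    case (relator l r u v)
    then show ?case
      using relators_words[of l r] ev_rel[of l r] by (simp add: ev_append)
  qed auto
  define F where "F X = ev (SOME w. w \<in> X)" for X
  have F_cl: "F (cl w) = ev w" if "w \<in> W" for w
  proof -
    have "w \<in> cl w" using that by (simp add: hnn_class_def hnn_cong.refl)
    then have "(SOME w'. w' \<in> cl w) \<in> cl w" by (rule someI)
    then show ?thesis using ev_cong by (auto simp: F_def hnn_class_def)
  qed
  show ?thesis
    using fc s
    by (intro exI[of _ F])
      (auto simp: hom_def carrier_H mult_H F_cl ev_append ev_closed hnn_base_def hnn_stable_def)
qed

end

end

theory Submission
  imports Defs
begin

text \<open>
  It suffices to find a least upper bound in \<open>P*\<close> of a single \<open>x = p q\<inverse>\<close> with \<open>p, q \<in> P*\<close>, by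
  induction on the number of letters \<open>t\<close> in \<open>p\<close> and \<open>q\<close>.  Normal forms of the HNN extension are
  taken with respect to the minimal coset representatives.  If the normal form of \<open>x\<close> starts with
  \<open>y t\<close>, then \<open>y \<in> P\<close> and \<open>y t\<close> is a prefix of every upper bound of \<open>x\<close>, so it can be split off.
  If a letter \<open>t\<close> of \<open>p\<close> cancels in \<open>x\<close>, closure of \<open>B\<close> under joins rewrites \<open>x\<close> as a quotient
  with fewer letters \<open>t\<close>.  What remains is \<open>x \<in> G\<close>, where every upper bound of \<open>x\<close> in \<open>P*\<close> lies
  above one in \<open>P\<close>.
\<close>

section \<open>From least upper bounds of single elements to those of finite sets\<close>

lemma (in group) mult_inv_mult:
  assumes "x \<in> carrier G" "y \<in> carrier G"
  shows "x \<otimes> (inv x \<otimes> y) = y" "inv x \<otimes> (x \<otimes> y) = y"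
  using assms by (simp_all flip: m_assoc)

text \<open>Induction over the finite set: if \<open>u\<close> is the least upper bound of
  \<open>F\<close>, left translation by \<open>inv u\<close> carries the upper bounds of
  \<open>insert x F\<close> to the upper bounds in \<open>Q\<close> of the single element
  \<open>inv u \<otimes> x\<close>, and a least one translates back by \<open>u\<close>.\<close>

lemma quasi_lattice_orderedI:
  assumes "group K" and subset: "Q \<subseteq> carrier K"
    and closed: "\<And>x y. x \<in> Q \<Longrightarrow> y \<in> Q \<Longrightarrow> x \<otimes>\<^bsub>K\<^esub> y \<in> Q"
    and one: "\<one>\<^bsub>K\<^esub> \<in> Q"
    and pointed: "\<And>x. x \<in> Q \<Longrightarrow> inv\<^bsub>K\<^esub> x \<in> Q \<Longrightarrow> x = \<one>\<^bsub>K\<^esub>"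
    and lub: "\<And>x u. x \<in> carrier K \<Longrightarrow> upper_bound_in K Q {x} u \<Longrightarrow> \<exists>u. lub_in K Q {x} u"
  shows "quasi_lattice_ordered K Q"
proof -
  interpret group K by fact
  show ?thesis
  proof
    have "x = \<one>\<^bsub>K\<^esub>" if "x \<in> Q" "y \<in> Q" "x = inv\<^bsub>K\<^esub> y" for x y
      using pointed[of x] that subset by auto
    moreover have "\<one>\<^bsub>K\<^esub> \<in> set_inv\<^bsub>K\<^esub> Q"
      using one by (auto simp: SET_INV_def intro: bexI[of _ "\<one>\<^bsub>K\<^esub>"])
    ultimately show "Q \<inter> set_inv\<^bsub>K\<^esub> Q = {\<one>\<^bsub>K\<^esub>}"
      using one by (auto simp: SET_INV_def)
  next
    fix F assume "finite F" "F \<subseteq> carrier K" "\<exists>u. upper_bound_in K Q F u"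
    then show "\<exists>u. lub_in K Q F u"
    proof (induction F)
      case empty
      then show ?case
        using one subset
        by (intro exI[of _ "\<one>\<^bsub>K\<^esub>"]) (auto simp: lub_in_def upper_bound_in_def cone_le_def)
    next
      case (insert x F)
      then obtain v where v: "upper_bound_in K Q (insert x F) v" by blast
      then have "upper_bound_in K Q F v" by (simp add: upper_bound_in_def)
      then obtain u where u: "lub_in K Q F u" using insert by blast
      have c: "x \<in> carrier K" "u \<in> carrier K" "F \<subseteq> carrier K" and uQ: "u \<in> Q"
        using insert u subset by (auto simp: lub_in_def upper_bound_in_def)
      have bound: "upper_bound_in K Q {inv\<^bsub>K\<^esub> u \<otimes>\<^bsub>K\<^esub> x} (inv\<^bsub>K\<^esub> u \<otimes>\<^bsub>K\<^esub> y)"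
        if y: "upper_bound_in K Q (insert x F) y" for y
      proof -
        have "y \<in> carrier K" using y subset by (auto simp: upper_bound_in_def)
        then show ?thesis
          using y u c
          by (auto simp: upper_bound_in_def lub_in_def cone_le_def inv_mult_group m_assoc
              mult_inv_mult)
      qed
      obtain w where w: "lub_in K Q {inv\<^bsub>K\<^esub> u \<otimes>\<^bsub>K\<^esub> x} w"
        using lub[OF _ bound[OF v]] c by auto
      then have wQ: "w \<in> Q" and wc: "w \<in> carrier K"
        using subset by (auto simp: lub_in_def upper_bound_in_def)
      have "inv\<^bsub>K\<^esub> y \<otimes>\<^bsub>K\<^esub> (u \<otimes>\<^bsub>K\<^esub> w) \<in> Q" if "y \<in> F" for y
      proof -
        have "inv\<^bsub>K\<^esub> y \<otimes>\<^bsub>K\<^esub> u \<in> Q" "y \<in> carrier K"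
          using u that c by (auto simp: lub_in_def upper_bound_in_def cone_le_def)
        then show ?thesis using closed[OF _ wQ] c wc by (simp flip: m_assoc)
      qed
      moreover have "inv\<^bsub>K\<^esub> x \<otimes>\<^bsub>K\<^esub> (u \<otimes>\<^bsub>K\<^esub> w) \<in> Q"
        using w c wc by (simp add: lub_in_def upper_bound_in_def cone_le_def inv_mult_group m_assoc)
      ultimately have "upper_bound_in K Q (insert x F) (u \<otimes>\<^bsub>K\<^esub> w)"
        using closed uQ wQ by (auto simp: upper_bound_in_def cone_le_def)
      moreover have "cone_le K Q (u \<otimes>\<^bsub>K\<^esub> w) y" if y: "upper_bound_in K Q (insert x F) y" for y
      proof -
        have "y \<in> carrier K" using y subset by (auto simp: upper_bound_in_def)
        then show ?thesis
          using bound[OF y] w c wc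
          by (auto simp: lub_in_def cone_le_def inv_mult_group m_assoc)
      qed
      ultimately show ?case by (auto simp: lub_in_def)
    qed
  qed (use subset closed in auto)
qed

section \<open>Normal forms\<close>

text \<open>
  \<open>Step x True s\<close> stands for \<open>x t s\<close> and \<open>Step x False s\<close> for \<open>x t\<inverse> s\<close>.
\<close>

datatype 'a normal_form = End 'a | Step 'a bool "'a normal_form"

primrec signs :: "'a normal_form \<Rightarrow> bool list" where
  "signs (End g) = []"
| "signs (Step x e s) = e # signs s"

text \<open>
  The index \<open>True\<close> belongs to \<open>A\<close> and \<open>\<phi>\<close>, the index \<open>False\<close> to \<open>B\<close> and the inverse of \<open>\<phi>\<close>;
  \<open>\<tau> e\<close> picks representatives of the left cosets of \<open>S e\<close>.
\<close>

locale hnn_transversal = hnn_data G A \<phi> for G (structure) and A \<phi> +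
  fixes S :: "bool \<Rightarrow> 'a set" and \<psi> :: "bool \<Rightarrow> 'a \<Rightarrow> 'a" and \<tau> :: "bool \<Rightarrow> 'a \<Rightarrow> 'a"
  assumes S_True: "S True = A" and psi_True: "a \<in> A \<Longrightarrow> \<psi> True a = \<phi> a"
    and S_subgroup: "subgroup (S e) G"
    and psi_closed: "a \<in> S e \<Longrightarrow> \<psi> e a \<in> S (\<not> e)"
    and psi_mult: "a \<in> S e \<Longrightarrow> b \<in> S e \<Longrightarrow> \<psi> e (a \<otimes> b) = \<psi> e a \<otimes> \<psi> e b"
    and psi_psi: "a \<in> S e \<Longrightarrow> \<psi> (\<not> e) (\<psi> e a) = a"
    and rep_closed: "g \<in> carrier G \<Longrightarrow> \<tau> e g \<in> carrier G"
    and rep_coset: "g \<in> carrier G \<Longrightarrow> inv (\<tau> e g) \<otimes> g \<in> S e"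
    and rep_mult: "g \<in> carrier G \<Longrightarrow> a \<in> S e \<Longrightarrow> \<tau> e (g \<otimes> a) = \<tau> e g"
    and rep_one: "\<tau> e \<one> = \<one>"
begin

lemma S_carrier: "a \<in> S e \<Longrightarrow> a \<in> carrier G"
  by (rule subgroup.mem_carrier[OF S_subgroup])

lemma S_mult: "a \<in> S e \<Longrightarrow> b \<in> S e \<Longrightarrow> a \<otimes> b \<in> S e"
  by (rule subgroup.m_closed[OF S_subgroup])

lemma S_inv: "a \<in> S e \<Longrightarrow> inv a \<in> S e"
  by (rule subgroup.m_inv_closed[OF S_subgroup])

lemma S_one: "\<one> \<in> S e"
  by (rule subgroup.one_closed[OF S_subgroup])

lemma psi_carrier: "a \<in> S e \<Longrightarrow> \<psi> e a \<in> carrier G"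
  by (rule S_carrier[OF psi_closed])

lemma psi_one: "\<psi> e \<one> = \<one>"
proof -
  have "\<psi> e \<one> \<otimes> \<psi> e \<one> = \<psi> e \<one>"
    using psi_mult[OF S_one S_one, of e] by simp
  then show ?thesis
    using psi_carrier[OF S_one, of e] by simp
qed

lemma rep_eqD:
  assumes "g \<in> carrier G" "h \<in> carrier G" "\<tau> e g = \<tau> e h"
  shows "inv g \<otimes> h \<in> S e"
proof -
  have "inv (inv (\<tau> e g) \<otimes> g) \<otimes> (inv (\<tau> e h) \<otimes> h) \<in> S e"
    using S_mult[OF S_inv[OF rep_coset] rep_coset] assms(1,2) .
  also have "inv (inv (\<tau> e g) \<otimes> g) \<otimes> (inv (\<tau> e h) \<otimes> h) = inv g \<otimes> h"
    using assms rep_closed[of h e]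
    by (simp add: inv_mult_group m_assoc mult_inv_mult rep_closed)
  finally show ?thesis .
qed

lemma rep_S: "a \<in> S e \<Longrightarrow> \<tau> e a = \<one>"
  using rep_mult[of \<one> a e] by (simp add: S_carrier rep_one)

lemma rep_mult_rep:
  assumes "g \<in> carrier G" "h \<in> carrier G"
  shows "\<tau> e (h \<otimes> \<tau> e g) = \<tau> e (h \<otimes> g)"
proof -
  have "\<tau> e (h \<otimes> g) = \<tau> e (h \<otimes> \<tau> e g \<otimes> (inv (\<tau> e g) \<otimes> g))"
    using assms rep_closed[of g e] by (simp add: m_assoc mult_inv_mult)
  also have "\<dots> = \<tau> e (h \<otimes> \<tau> e g)"
    using assms by (intro rep_mult rep_coset) (auto simp: rep_closed)
  finally show ?thesis by simp
qed

lemma rep_rep: "g \<in> carrier G \<Longrightarrow> \<tau> e (\<tau> e g) = \<tau> e g"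
  using rep_mult_rep[of g \<one> e] by (simp add: rep_closed)

lemma rep_eq_one_iff: "g \<in> carrier G \<Longrightarrow> \<tau> e g = \<one> \<longleftrightarrow> g \<in> S e"
  using rep_eqD[of \<one> g e] by (auto simp: rep_S rep_one)

text \<open>A normal form starting with \<open>t\<close> or \<open>t\<inverse>\<close> itself cancels against the opposite letter.\<close>

definition starts :: "bool \<Rightarrow> 'a normal_form \<Rightarrow> bool" where
  "starts e s \<longleftrightarrow> (\<exists>r. s = Step \<one> e r)"

text \<open>A letter and a following opposite letter can be removed only if the syllable between
  them lies in the subgroup of the second letter. That syllable is a chosen representative, so it
  would be the identity, which is the case \<open>starts\<close> excludes.\<close>

primrec valid :: "'a normal_form \<Rightarrow> bool" where
  "valid (End g) \<longleftrightarrow> g \<in> carrier G"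
| "valid (Step x e s) \<longleftrightarrow> x \<in> carrier G \<and> \<tau> e x = x \<and> valid s \<and> \<not> starts (\<not> e) s"

text \<open>The product \<open>h \<otimes> x\<close> splits into its representative and a remainder
  in \<open>S e\<close>; the remainder crosses the stable letter as its image under
  \<open>\<psi> e\<close> and acts on the tail.\<close>

primrec base_act :: "'a \<Rightarrow> 'a normal_form \<Rightarrow> 'a normal_form" where
  "base_act h (End g) = End (h \<otimes> g)"
| "base_act h (Step x e s) =
     Step (\<tau> e (h \<otimes> x)) e (base_act (\<psi> e (inv (\<tau> e (h \<otimes> x)) \<otimes> (h \<otimes> x))) s)"

definition stable_act :: "bool \<Rightarrow> 'a normal_form \<Rightarrow> 'a normal_form" where
  "stable_act e s = (if starts (\<not> e) s then (case s of Step x e' r \<Rightarrow> r) else Step \<one> e s)"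

section \<open>The action of the HNN extension on normal forms\<close>

lemma stable_act_cancel: "stable_act e (Step \<one> (\<not> e) r) = r"
  by (simp add: stable_act_def starts_def)

lemma stable_act_push: "\<not> starts (\<not> e) s \<Longrightarrow> stable_act e s = Step \<one> e s"
  by (simp add: stable_act_def)

lemma signs_base_act [simp]: "signs (base_act h s) = signs s"
  by (induction s arbitrary: h) auto

lemma residue_closed: "g \<in> carrier G \<Longrightarrow> \<psi> e (inv (\<tau> e g) \<otimes> g) \<in> carrier G"
  by (intro psi_carrier rep_coset)

lemma base_act_one: "valid s \<Longrightarrow> base_act \<one> s = s"
  by (induction s) (auto simp: psi_one)

text \<open>Remainders multiply: that of \<open>g \<otimes> (h \<otimes> x)\<close> is that of
  \<open>g \<otimes> y\<close> times that of \<open>h \<otimes> x\<close>, where \<open>y\<close>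
  represents \<open>h \<otimes> x\<close>; and \<open>\<psi> e\<close> is multiplicative.\<close>

lemma base_act_mult:
  "valid s \<Longrightarrow> g \<in> carrier G \<Longrightarrow> h \<in> carrier G \<Longrightarrow> base_act g (base_act h s) = base_act (g \<otimes> h) s"
proof (induction s arbitrary: g h)
  case (Step x e s)
  define y where "y = \<tau> e (h \<otimes> x)"
  define z where "z = \<tau> e (g \<otimes> (h \<otimes> x))"
  have c: "x \<in> carrier G" "y \<in> carrier G" "z \<in> carrier G"
    using Step.prems by (auto simp: y_def z_def rep_closed)
  have gy: "\<tau> e (g \<otimes> y) = z"
    using Step.prems by (simp add: y_def z_def rep_mult_rep)
  have a: "inv y \<otimes> (h \<otimes> x) \<in> S e"
    unfolding y_def using Step.prems by (intro rep_coset) auto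
  have b: "inv z \<otimes> (g \<otimes> y) \<in> S e"
    unfolding gy[symmetric] using Step.prems c by (intro rep_coset) auto
  have "\<psi> e (inv z \<otimes> (g \<otimes> y)) \<otimes> \<psi> e (inv y \<otimes> (h \<otimes> x))
      = \<psi> e (inv z \<otimes> (g \<otimes> y) \<otimes> (inv y \<otimes> (h \<otimes> x)))"
    using a b by (simp add: psi_mult)
  also have "inv z \<otimes> (g \<otimes> y) \<otimes> (inv y \<otimes> (h \<otimes> x)) = inv z \<otimes> (g \<otimes> (h \<otimes> x))"
    using Step.prems c by (simp add: m_assoc mult_inv_mult)
  finally show ?case
    using Step.prems Step.IH[of "\<psi> e (inv z \<otimes> (g \<otimes> y))" "\<psi> e (inv y \<otimes> (h \<otimes> x))"]
      a b gy psi_carrier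
    by (simp add: m_assoc flip: y_def z_def)
qed (simp add: m_assoc)

text \<open>Left multiplication by \<open>b\<close> keeps a leading syllable inside or outside the
  coset \<open>S e\<close>, which the identity represents. So the remainder that
  \<open>base_act\<close> passes to a tail, an element of \<open>S (\<not> e)\<close>, cannot make
  the tail start with a cancelling letter.\<close>

lemma starts_base_act:
  assumes "b \<in> S e" "valid s"
  shows "starts e (base_act b s) \<longleftrightarrow> starts e s"
proof (cases s)
  case (Step x e' r)
  have "\<tau> e (b \<otimes> x) = \<one> \<longleftrightarrow> x = \<one>" if [simp]: "e' = e"
  proof
    assume "\<tau> e (b \<otimes> x) = \<one>"
    then have "b \<otimes> x \<in> S e"
      using assms Step by (subst (asm) rep_eq_one_iff) (auto simp: S_carrier)
    then have "inv b \<otimes> (b \<otimes> x) \<in> S e"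
      using S_mult[OF S_inv] assms by blast
    then have "x \<in> S e"
      using assms Step by (simp add: S_carrier mult_inv_mult)
    then show "x = \<one>"
      using assms Step rep_S[of x e] by simp
  qed (use assms in \<open>simp add: S_carrier rep_S\<close>)
  then show ?thesis using Step by (auto simp: starts_def)
qed (simp add: starts_def)

lemma valid_base_act: "valid s \<Longrightarrow> g \<in> carrier G \<Longrightarrow> valid (base_act g s)"
proof (induction s arbitrary: g)
  case (Step x e s)
  then have c: "g \<otimes> x \<in> carrier G" by simp
  have "\<psi> e (inv (\<tau> e (g \<otimes> x)) \<otimes> (g \<otimes> x)) \<in> S (\<not> e)"
    using c by (intro psi_closed rep_coset)
  then show ?case
    using Step c by (simp add: starts_base_act rep_closed rep_rep residue_closed)
qed simp

lemma valid_stable_act: "valid s \<Longrightarrow> valid (stable_act e s)"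
  by (auto simp: stable_act_def starts_def rep_one)

lemma stable_act_inverse: "valid s \<Longrightarrow> stable_act (\<not> e) (stable_act e s) = s"
  by (cases s) (auto simp: stable_act_def starts_def)

text \<open>The defining relation of the HNN extension, in a form covering both letters. If the
  letter cancels, the two sides agree because \<open>\<psi> (\<not> e)\<close> undoes
  \<open>\<psi> e\<close>.\<close>

lemma base_act_stable_act:
  assumes "valid s" "a \<in> S e"
  shows "base_act a (stable_act e s) = stable_act e (base_act (\<psi> e a) s)"
proof (cases "starts (\<not> e) s")
  case True
  then obtain r where r: "s = Step \<one> (\<not> e) r" by (auto simp: starts_def)
  have "\<psi> e a \<in> S (\<not> e)" using assms by (intro psi_closed)
  then show ?thesis
    using assms unfolding r
    by (simp add: stable_act_cancel rep_S S_carrier psi_psi)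
next
  case False
  then have "\<not> starts (\<not> e) (base_act (\<psi> e a) s)"
    using assms by (simp add: starts_base_act psi_closed)
  with False assms show ?thesis
    by (simp add: stable_act_push rep_S S_carrier)
qed

primrec letter_act :: "'a hnn_letter \<Rightarrow> 'a normal_form \<Rightarrow> 'a normal_form" where
  "letter_act (Base g) = base_act g"
| "letter_act Stable = stable_act True"
| "letter_act Stable_inv = stable_act False"

abbreviation word_act :: "'a hnn_letter list \<Rightarrow> 'a normal_form \<Rightarrow> 'a normal_form" where
  "word_act \<equiv> foldr letter_act"

lemma valid_word_act: "w \<in> W \<Longrightarrow> valid s \<Longrightarrow> valid (word_act w s)"
proof (induction w)
  case (Cons x w)
  then show ?case by (cases x) (auto simp: valid_base_act valid_stable_act)
qed simp

lemma word_act_relator: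
  assumes "(l, r) \<in> hnn_relators G A \<phi>" "valid s"
  shows "word_act l s = word_act r s"
proof -
  have "stable_act False (base_act a (stable_act True s)) = base_act (\<phi> a) s" if "a \<in> A" for a
    using that assms base_act_stable_act[of s a True] S_True psi_True[OF that]
      valid_base_act[of s "\<phi> a"] psi_carrier[of a True]
      stable_act_inverse[of "base_act (\<phi> a) s" True]
    by simp
  then show ?thesis
    using assms stable_act_inverse[OF assms(2), of True] stable_act_inverse[OF assms(2), of False]
    by (auto simp: hnn_relators_def base_act_mult base_act_one)
qed

text \<open>Both sides of every relator act alike, so the action descends to the HNN extension.
  Hence the normal form of an element, its action on \<open>End \<one>\<close>, does not depend on
  the chosen word.\<close>

lemma word_act_cong: "(u, v) \<in> hnn_cong G A \<phi> \<Longrightarrow> valid s \<Longrightarrow> word_act u s = word_act v s"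
  by (induction rule: hnn_cong.induct) (simp_all add: word_act_relator valid_word_act)

definition act :: "'a hnn_letter list set \<Rightarrow> 'a normal_form \<Rightarrow> 'a normal_form" where
  "act X s = word_act (SOME w. w \<in> X) s"

lemma act_class:
  assumes "w \<in> W" "valid s"
  shows "act (cl w) s = word_act w s"
proof -
  have "w \<in> cl w" using assms by (simp add: hnn_class_def hnn_cong.refl)
  then have "(SOME w'. w' \<in> cl w) \<in> cl w" by (rule someI)
  then show ?thesis using assms by (simp add: act_def hnn_class_def word_act_cong)
qed

lemma act_base: "g \<in> carrier G \<Longrightarrow> valid s \<Longrightarrow> act (hnn_base G A \<phi> g) s = base_act g s"
  by (simp add: hnn_base_def act_class)

lemma act_stable: "valid s \<Longrightarrow> act (hnn_stable G A \<phi>) s = stable_act True s"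
  by (simp add: hnn_stable_def act_class)

lemma act_inv_stable: "valid s \<Longrightarrow> act (inv\<^bsub>H\<^esub> (hnn_stable G A \<phi>)) s = stable_act False s"
  by (simp add: inv_hnn_stable act_class)

lemma act_one: "valid s \<Longrightarrow> act \<one>\<^bsub>H\<^esub> s = s"
  by (simp add: one_H act_class)

lemma act_mult:
  "X \<in> carrier H \<Longrightarrow> Y \<in> carrier H \<Longrightarrow> valid s \<Longrightarrow> act (X \<otimes>\<^bsub>H\<^esub> Y) s = act X (act Y s)"
  by (auto simp: carrier_H mult_H act_class valid_word_act)

lemma valid_act: "X \<in> carrier H \<Longrightarrow> valid s \<Longrightarrow> valid (act X s)"
  by (auto simp: carrier_H act_class valid_word_act)

end

section \<open>Upper bounds of one element under inversion and translation\<close>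

lemma (in group) lub_in_singleton_iff:
  "lub_in G Q {x} u \<longleftrightarrow>
    u \<in> Q \<and> inv x \<otimes> u \<in> Q \<and> (\<forall>v\<in>Q. inv x \<otimes> v \<in> Q \<longrightarrow> inv u \<otimes> v \<in> Q)"
  by (auto simp: lub_in_def upper_bound_in_def cone_le_def)

text \<open>Since \<open>v\<close> bounds \<open>inv x\<close> exactly when \<open>v\<close> and
  \<open>x \<otimes> v\<close> are both in \<open>Q\<close>, left translation by \<open>x\<close>
  turns the upper bounds of \<open>inv x\<close> into those of \<open>x\<close>. This lets numerator
  and denominator of a quotient swap roles.\<close>

lemma (in group) lub_in_inv:
  assumes "x \<in> carrier G" "Q \<subseteq> carrier G" "lub_in G Q {inv x} v"
  shows "lub_in G Q {x} (x \<otimes> v)"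
proof -
  have v: "v \<in> Q" "v \<in> carrier G" "x \<otimes> v \<in> Q"
    and least: "\<And>w. w \<in> Q \<Longrightarrow> x \<otimes> w \<in> Q \<Longrightarrow> inv v \<otimes> w \<in> Q"
    using assms by (auto simp: lub_in_singleton_iff)
  have "inv (x \<otimes> v) \<otimes> w \<in> Q" if "w \<in> Q" "inv x \<otimes> w \<in> Q" for w
  proof -
    have "w \<in> carrier G" using that assms by auto
    then show ?thesis
      using least[of "inv x \<otimes> w"] that assms v by (simp add: mult_inv_mult inv_mult_group m_assoc)
  qed
  then show ?thesis
    using v assms by (simp add: lub_in_singleton_iff mult_inv_mult)
qed

text \<open>Left translation by \<open>c\<close> preserves the order, and the premise
  \<open>above\<close> ensures that every upper bound of \<open>c \<otimes> x\<close> in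
  \<open>Q\<close> is the translate of an upper bound of \<open>x\<close> in
  \<open>Q\<close>.\<close>

lemma (in group) lub_in_shift:
  assumes Q: "Q \<subseteq> carrier G" "\<And>x y. x \<in> Q \<Longrightarrow> y \<in> Q \<Longrightarrow> x \<otimes> y \<in> Q"
    and x: "x \<in> carrier G" and c: "c \<in> Q" and lub: "lub_in G Q {x} u"
    and above: "\<And>w. w \<in> Q \<Longrightarrow> inv (c \<otimes> x) \<otimes> w \<in> Q \<Longrightarrow> inv c \<otimes> w \<in> Q"
  shows "lub_in G Q {c \<otimes> x} (c \<otimes> u)"
proof -
  have u: "u \<in> Q" "u \<in> carrier G" "inv x \<otimes> u \<in> Q" and cG: "c \<in> carrier G"
    and least: "\<And>w. w \<in> Q \<Longrightarrow> inv x \<otimes> w \<in> Q \<Longrightarrow> inv u \<otimes> w \<in> Q"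
    using lub Q(1) c by (auto simp: lub_in_singleton_iff)
  have "inv (c \<otimes> u) \<otimes> w \<in> Q" if w: "w \<in> Q" "inv (c \<otimes> x) \<otimes> w \<in> Q" for w
  proof -
    have "w \<in> carrier G" using w Q(1) by auto
    then show ?thesis
      using least[OF above[OF w]] w(2) x cG u by (simp add: inv_mult_group m_assoc)
  qed
  then show ?thesis
    using u c cG x Q(2) by (simp add: lub_in_singleton_iff mult_inv_mult inv_mult_group m_assoc)
qed

section \<open>The cone of the HNN extension\<close>

locale hnn_quasi_lattice = quasi_lattice_ordered G P for G (structure) and P +
  fixes A B :: "'a set" and \<phi> :: "'a \<Rightarrow> 'a"
  assumes A: "subgroup A G" and B: "subgroup B G"
    and phi_iso: "\<phi> \<in> iso (G\<lparr>carrier := A\<rparr>) (G\<lparr>carrier := B\<rparr>)"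
    and phi_cone: "\<phi> ` (A \<inter> P) = B \<inter> P"
    and min_rep: "\<And>g. \<lbrakk>g \<in> carrier G; (g <#\<^bsub>G\<^esub> A) \<inter> P \<noteq> {}\<rbrakk> \<Longrightarrow>
      \<exists>p \<in> (g <#\<^bsub>G\<^esub> A) \<inter> P. \<forall>q \<in> (g <#\<^bsub>G\<^esub> A) \<inter> P. cone_le G P p q"
    and join_closed: "\<And>x y. \<lbrakk>x \<in> B; y \<in> B; join_finite G P x y\<rbrakk> \<Longrightarrow> join G P x y \<in> B"
begin

section \<open>The paired subgroups and their coset representatives\<close>

definition side :: "bool \<Rightarrow> 'a set" where
  "side e = (if e then A else B)"

definition side_map :: "bool \<Rightarrow> 'a \<Rightarrow> 'a" where
  "side_map e = (if e then \<phi> else inv_into A \<phi>)"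

definition min_in :: "'a set \<Rightarrow> 'a \<Rightarrow> bool" where
  "min_in C p \<longleftrightarrow> p \<in> C \<inter> P \<and> (\<forall>q \<in> C \<inter> P. cone_le G P p q)"

text \<open>Cosets of \<open>A\<close> that meet \<open>P\<close> get a minimal representative. The
  second branch represents a subgroup itself by the identity, as normal forms require; the last
  choice is arbitrary but depends on the coset alone.\<close>

definition rep :: "bool \<Rightarrow> 'a \<Rightarrow> 'a" where
  "rep e g =
    (if e \<and> (g <# A) \<inter> P \<noteq> {} then SOME p. min_in (g <# A) p
     else if g \<in> side e then \<one> else SOME h. h \<in> g <# side e)"

lemma side_subgroup: "subgroup (side e) G"
  using A B by (simp add: side_def)

lemma cone_one: "\<one> \<in> P"
  using cone_pointed by auto

lemma cone_inv: "p \<in> P \<Longrightarrow> inv p \<in> P \<Longrightarrow> p = \<one>"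
  using cone_pointed cone_subset by (force simp: SET_INV_def)

lemma cone_carrier: "p \<in> P \<Longrightarrow> p \<in> carrier G"
  using cone_subset by auto

lemma min_in_rep:
  assumes "g \<in> carrier G" "(g <# A) \<inter> P \<noteq> {}"
  shows "min_in (g <# A) (rep True g)"
proof -
  have "\<exists>p. min_in (g <# A) p"
    using min_rep[OF assms] by (auto simp: min_in_def)
  then show ?thesis using assms by (auto simp: rep_def intro: someI_ex)
qed

lemma mem_coset_self: "g \<in> carrier G \<Longrightarrow> g \<in> g <# side e"
  using subgroup.one_closed[OF side_subgroup] by (force simp: l_coset_def)

lemma rep_mem_coset:
  assumes "g \<in> carrier G"
  shows "rep e g \<in> g <# side e"
proof (cases "e \<and> (g <# A) \<inter> P \<noteq> {}")
  case True
  then show ?thesis using min_in_rep[OF assms] by (simp add: min_in_def side_def)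
next
  case False
  have "\<one> \<in> g <# side e" if "g \<in> side e"
    using coset_join3[OF assms side_subgroup that] subgroup.one_closed[OF side_subgroup] by simp
  then show ?thesis
    using False someI[of "\<lambda>h. h \<in> g <# side e", OF mem_coset_self[OF assms]]
    by (auto simp: rep_def)
qed

text \<open>As \<open>p\<close> lies in its own coset, the minimal representative is below it. So
  the remainder in \<open>A\<close> is positive, and it stays positive when it crosses the stable
  letter.\<close>

lemma rep_cone:
  assumes "p \<in> P"
  shows "rep True p \<in> P" "inv (rep True p) \<otimes> p \<in> P"
  using min_in_rep[of p] mem_coset_self[of p True] assms cone_carrier[OF assms]
  by (auto simp: min_in_def cone_le_def side_def)

lemma phi_hom: "a \<in> A \<Longrightarrow> b \<in> A \<Longrightarrow> \<phi> (a \<otimes> b) = \<phi> a \<otimes> \<phi> b"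
  using phi_iso by (auto simp: iso_def hom_def)

lemma phi_bij: "bij_betw \<phi> A B"
  using phi_iso by (auto simp: iso_def)

lemma side_map_closed: "a \<in> side e \<Longrightarrow> side_map e a \<in> side (\<not> e)"
  using phi_bij by (auto simp: side_def side_map_def bij_betw_def inv_into_into)

lemma side_map_side_map: "a \<in> side e \<Longrightarrow> side_map (\<not> e) (side_map e a) = a"
  using phi_bij by (auto simp: side_def side_map_def bij_betw_def f_inv_into_f)

lemma side_map_mult:
  assumes "a \<in> side e" "b \<in> side e"
  shows "side_map e (a \<otimes> b) = side_map e a \<otimes> side_map e b"
proof (cases e)
  case True
  then show ?thesis using assms phi_hom by (simp add: side_def side_map_def)
next
  case False
  let ?x = "side_map e a" and ?y = "side_map e b"
  have xy: "?x \<in> A" "?y \<in> A" "?x \<otimes> ?y \<in> A" "\<phi> ?x = a" "\<phi> ?y = b"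
    using False side_map_closed[OF assms(1)] side_map_closed[OF assms(2)]
      side_map_side_map[OF assms(1)] side_map_side_map[OF assms(2)]
    by (auto simp: side_def side_map_def intro: subgroup.m_closed[OF A])
  then have "side_map e (\<phi> (?x \<otimes> ?y)) = ?x \<otimes> ?y"
    using False phi_bij by (simp add: side_map_def bij_betw_def)
  then show ?thesis using xy by (simp add: phi_hom)
qed

lemma side_map_cone:
  assumes "b \<in> side e" "b \<in> P"
  shows "side_map e b \<in> P"
proof (cases e)
  case True
  then show ?thesis using assms phi_cone by (auto simp: side_def side_map_def)
next
  case False
  then obtain a where "a \<in> A" "a \<in> P" "b = \<phi> a"
    using assms phi_cone by (auto simp: side_def)
  then show ?thesis
    using False phi_bij by (simp add: side_map_def bij_betw_def)
qed

lemma rep_carrier: "g \<in> carrier G \<Longrightarrow> rep e g \<in> carrier G"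
  by (rule subsetD[OF l_coset_subset_G[OF subgroup.subset[OF side_subgroup]] rep_mem_coset])

lemma rep_diff:
  assumes "g \<in> carrier G"
  shows "inv (rep e g) \<otimes> g \<in> side e"
proof -
  obtain a where a: "a \<in> side e" "rep e g = g \<otimes> a"
    using rep_mem_coset[OF assms, of e] by (auto simp: l_coset_def)
  then show ?thesis
    using assms subgroup.mem_carrier[OF side_subgroup a(1)]
      subgroup.m_inv_closed[OF side_subgroup a(1)]
    by (simp add: inv_mult_group m_assoc)
qed

lemma rep_mult_side:
  assumes "g \<in> carrier G" "a \<in> side e"
  shows "rep e (g \<otimes> a) = rep e g"
proof -
  have a: "a \<in> carrier G" by (rule subgroup.mem_carrier[OF side_subgroup assms(2)])
  have "(g \<otimes> a) <# side e = g <# (a <# side e)"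
    using assms(1) a by (simp add: lcos_m_assoc subgroup.subset[OF side_subgroup])
  also have "a <# side e = side e"
    by (rule coset_join3[OF a side_subgroup assms(2)])
  finally have "(g \<otimes> a) <# side e = g <# side e" .
  moreover have "g \<otimes> a \<in> side e \<longleftrightarrow> g \<in> side e"
  proof
    assume "g \<otimes> a \<in> side e"
    then have "g \<otimes> a \<otimes> inv a \<in> side e"
      by (rule subgroup.m_closed[OF side_subgroup _ subgroup.m_inv_closed[OF side_subgroup assms(2)]])
    then show "g \<in> side e" using assms a by (simp add: m_assoc)
  qed (rule subgroup.m_closed[OF side_subgroup _ assms(2)])
  ultimately show ?thesis by (simp add: rep_def side_def split: if_splits)
qed

lemma rep_at_one: "rep e \<one> = \<one>"
proof (cases e)
  case True
  \<comment> \<open>Minimality against the identity puts the inverse of the representative in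
    \<open>P\<close>, so pointedness applies.\<close>
  then show ?thesis using rep_cone[OF cone_one] cone_inv[of "rep True \<one>"] rep_carrier[of \<one> True] by simp
next
  case False
  then show ?thesis using subgroup.one_closed[OF B] by (simp add: rep_def side_def)
qed

end

sublocale hnn_quasi_lattice \<subseteq> hnn_transversal G A \<phi> side side_map rep
proof unfold_locales
  show "A \<subseteq> carrier G" by (rule subgroup.subset[OF A])
  show "\<phi> \<in> A \<rightarrow> carrier G"
    using phi_bij subgroup.subset[OF B] by (auto simp: bij_betw_def)
qed (simp_all add: side_subgroup side_map_closed side_map_mult side_map_side_map
      rep_carrier rep_diff rep_mult_side rep_at_one
      subgroup.subset[OF side_subgroup] subgroup.m_closed[OF side_subgroup]
      subgroup.one_closed[OF side_subgroup] subgroup.m_inv_closed[OF side_subgroup], simp_all add: side_def side_map_def)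

context hnn_quasi_lattice
begin

sublocale H: group H
  by (rule group_HNN)

abbreviation hmult (infixl "\<cdot>" 70) where "x \<cdot> y \<equiv> x \<otimes>\<^bsub>H\<^esub> y"
abbreviation "base \<equiv> hnn_base G A \<phi>"
abbreviation "stab \<equiv> hnn_stable G A \<phi>"
abbreviation "nf x \<equiv> act x (End \<one>)"

definition cone :: "'a hnn_letter list set set" where
  "cone = generated_subsemigroup H (base ` P \<union> {stab})"

section \<open>The embedded base group and the grading of the cone by stable letters\<close>

lemma base_closed [simp]: "g \<in> carrier G \<Longrightarrow> base g \<in> carrier H"
  using hnn_base_hom by (auto simp: hom_def)

lemma stable_closed [simp]: "stab \<in> carrier H"
  by (rule hnn_stable_closed)

lemma base_mult: "g \<in> carrier G \<Longrightarrow> h \<in> carrier G \<Longrightarrow> base g \<cdot> base h = base (g \<otimes> h)"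
  using hnn_base_hom by (simp add: hom_mult)

lemma base_one: "base \<one> = \<one>\<^bsub>H\<^esub>"
  using hom_one[OF hnn_base_hom is_group group_HNN] .

lemma base_inv: "g \<in> carrier G \<Longrightarrow> inv\<^bsub>H\<^esub> (base g) = base (inv g)"
  by (rule H.inv_equality) (simp_all add: base_mult base_one)

lemma base_mult_left:
  "g \<in> carrier G \<Longrightarrow> h \<in> carrier G \<Longrightarrow> x \<in> carrier H \<Longrightarrow>
    base g \<cdot> (base h \<cdot> x) = base (g \<otimes> h) \<cdot> x"
  by (simp add: base_mult flip: H.m_assoc)

lemma base_stable:
  assumes "b \<in> B" "x \<in> carrier H"
  shows "base (side_map False b) \<cdot> (stab \<cdot> x) = stab \<cdot> (base b \<cdot> x)"
proof -
  let ?a = "side_map False b"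
  have b: "b \<in> side False" using assms by (simp add: side_def)
  have a: "?a \<in> A" "?a \<in> carrier G" "b \<in> carrier G"
    using side_map_closed[OF b] S_carrier[OF b] psi_carrier[OF b] by (auto simp: side_def)
  have "\<phi> ?a = b"
    using side_map_side_map[OF b] by (simp add: side_map_def)
  then have "inv\<^bsub>H\<^esub> stab \<cdot> base ?a \<cdot> stab = base b"
    using hnn_relation[OF a(1)] by simp
  then have "stab \<cdot> base b = stab \<cdot> (inv\<^bsub>H\<^esub> stab \<cdot> (base ?a \<cdot> stab))"
    using a by (simp add: H.m_assoc)
  also have "\<dots> = base ?a \<cdot> stab"
    using a by (simp add: H.mult_inv_mult)
  finally have "base ?a \<cdot> stab = stab \<cdot> base b" by simp
  then show ?thesis using a assms by (simp flip: H.m_assoc)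
qed

text \<open>Products of n + 1 elements of \<open>P\<close> separated by n stable letters. The level
  of an element is unique, by \<open>signs_nf_level\<close>.\<close>

primrec level :: "nat \<Rightarrow> 'a hnn_letter list set set" where
  "level 0 = base ` P"
| "level (Suc n) = {base p \<cdot> (stab \<cdot> x) | p x. p \<in> P \<and> x \<in> level n}"

lemma level_SucI: "p \<in> P \<Longrightarrow> x \<in> level n \<Longrightarrow> base p \<cdot> (stab \<cdot> x) \<in> level (Suc n)"
  by auto

lemma level_carrier: "x \<in> level n \<Longrightarrow> x \<in> carrier H"
  by (induction n arbitrary: x) (auto simp: cone_carrier)

lemma level_base_mult: "p \<in> P \<Longrightarrow> x \<in> level n \<Longrightarrow> base p \<cdot> x \<in> level n"
proof (cases n)
  case (Suc m)
  assume "p \<in> P" "x \<in> level n"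
  then obtain q y where "q \<in> P" "y \<in> level m" "x = base q \<cdot> (stab \<cdot> y)"
    using Suc by auto
  then show ?thesis
    using Suc \<open>p \<in> P\<close> level_SucI[of "p \<otimes> q" y m]
    by (simp add: base_mult_left cone_carrier level_carrier cone_closed del: level.simps)
qed (auto simp: base_mult cone_carrier cone_closed)

lemma level_stab_mult: "x \<in> level n \<Longrightarrow> stab \<cdot> x \<in> level (Suc n)"
  using level_SucI[OF cone_one, of x n] level_carrier[of x n] by (simp add: base_one del: level.simps)

lemma level_mult: "x \<in> level m \<Longrightarrow> y \<in> level n \<Longrightarrow> x \<cdot> y \<in> level (m + n)"
proof (induction m arbitrary: x)
  case (Suc m)
  then obtain p z where "p \<in> P" "z \<in> level m" "x = base p \<cdot> (stab \<cdot> z)"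
    by auto
  then show ?case
    using Suc level_SucI[of p "z \<cdot> y" "m + n"] level_carrier[of y n] level_carrier[of z m]
    by (simp add: H.m_assoc cone_carrier del: level.simps)
qed (auto simp: level_base_mult)

text \<open>In a quotient \<open>p \<cdot> inv q\<close> the last stable letter of \<open>q\<close>
  is the one next to \<open>p\<close>, so a factor has to be split off on the right.\<close>

lemma level_snoc:
  "x \<in> level (Suc n) \<Longrightarrow> \<exists>y\<in>level n. \<exists>p\<in>P. x = y \<cdot> (stab \<cdot> base p)"
proof (induction n arbitrary: x)
  case 0
  then show ?case by auto
next
  case (Suc n)
  then obtain p z where pz: "p \<in> P" "z \<in> level (Suc n)" "x = base p \<cdot> (stab \<cdot> z)"
    by (subst (asm) level.simps) auto
  then obtain y q where yq: "y \<in> level n" "q \<in> P" "z = y \<cdot> (stab \<cdot> base q)"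
    using Suc.IH by blast
  have "x = base p \<cdot> (stab \<cdot> y) \<cdot> (stab \<cdot> base q)"
    using pz yq by (simp add: H.m_assoc cone_carrier level_carrier)
  then show ?case using yq(2) level_SucI[OF pz(1) yq(1)] by blast
qed

lemma base_mem_cone: "p \<in> P \<Longrightarrow> base p \<in> cone"
  by (auto simp: cone_def intro: generated_subsemigroup.incl)

lemma stab_mem_cone: "stab \<in> cone"
  by (auto simp: cone_def intro: generated_subsemigroup.incl)

lemma cone_H_mult: "x \<in> cone \<Longrightarrow> y \<in> cone \<Longrightarrow> x \<cdot> y \<in> cone"
  unfolding cone_def by (rule generated_subsemigroup.mult)

lemma cone_iff_level: "x \<in> cone \<longleftrightarrow> (\<exists>n. x \<in> level n)"
proof
  assume "x \<in> cone"
  then show "\<exists>n. x \<in> level n"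
    unfolding cone_def
  proof (induction rule: generated_subsemigroup.induct)
    case (incl x)
    have "stab \<in> level 1"
      using level_stab_mult[of "\<one>\<^bsub>H\<^esub>" 0] cone_one base_one by force
    moreover have "base p \<in> level 0" if "p \<in> P" for p
      using that by simp
    ultimately show ?case
      using incl by blast
  qed (blast intro: level_mult)
next
  have "x \<in> level n \<Longrightarrow> x \<in> cone" for n
    by (induction n arbitrary: x) (auto simp: base_mem_cone stab_mem_cone cone_H_mult)
  then show "\<exists>n. x \<in> level n \<Longrightarrow> x \<in> cone" by blast
qed

lemma cone_H_carrier: "cone \<subseteq> carrier H"
  by (auto simp: cone_iff_level level_carrier)

section \<open>Signs in the normal forms of cone elements and their quotients\<close>

lemma signs_act_base: "g \<in> carrier G \<Longrightarrow> valid s \<Longrightarrow> signs (act (base g) s) = signs s"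
  by (simp add: act_base)

lemma act_stable_inv_push:
  "valid s \<Longrightarrow> True \<notin> set (signs s) \<Longrightarrow> act (inv\<^bsub>H\<^esub> stab) s = Step \<one> False s"
  by (auto simp: act_inv_stable stable_act_def starts_def)

text \<open>With no inverse letter in the normal form, nothing cancels against t, so each factor
  \<open>stab\<close> adds one sign.\<close>

lemma signs_level:
  "x \<in> level n \<Longrightarrow> valid s \<Longrightarrow> False \<notin> set (signs s) \<Longrightarrow>
    signs (act x s) = replicate n True @ signs s"
proof (induction n arbitrary: x)
  case 0
  then show ?case by (auto simp: signs_act_base cone_carrier)
next
  case (Suc n)
  then obtain p y where py: "p \<in> P" "y \<in> level n" "x = base p \<cdot> (stab \<cdot> y)"
    by auto
  then have c: "p \<in> carrier G" "y \<in> carrier H" by (auto simp: cone_carrier level_carrier)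
  have IH: "signs (act y s) = replicate n True @ signs s"
    by (rule Suc.IH[OF py(2) Suc.prems(2,3)])
  then have "False \<notin> set (signs (act y s))" using Suc by simp
  then have "stable_act True (act y s) = Step \<one> True (act y s)"
    by (auto simp: stable_act_def starts_def)
  moreover have "act x s = base_act p (stable_act True (act y s))"
    using c py Suc.prems by (simp add: act_mult act_base act_stable valid_act valid_stable_act)
  ultimately show ?case
    using IH by simp
qed

lemma signs_nf_level: "x \<in> level n \<Longrightarrow> signs (nf x) = replicate n True"
  by (simp add: signs_level)

lemma signs_inv_level:
  "x \<in> level n \<Longrightarrow> valid s \<Longrightarrow> True \<notin> set (signs s) \<Longrightarrow>
    True \<notin> set (signs (act (inv\<^bsub>H\<^esub> x) s))"
proof (induction n arbitrary: x s)
  case 0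
  then show ?case by (auto simp: signs_act_base cone_carrier base_inv)
next
  case (Suc n)
  then obtain p y where py: "p \<in> P" "y \<in> level n" "x = base p \<cdot> (stab \<cdot> y)"
    by auto
  then have c: "p \<in> carrier G" "y \<in> carrier H" by (auto simp: cone_carrier level_carrier)
  let ?s = "act (base (inv p)) s"
  have s: "valid ?s" "True \<notin> set (signs ?s)"
    using Suc.prems c by (auto simp: valid_act signs_act_base)
  have "act (inv\<^bsub>H\<^esub> x) s = act (inv\<^bsub>H\<^esub> y) (act (inv\<^bsub>H\<^esub> stab) ?s)"
    using py c Suc.prems by (simp add: H.inv_mult_group H.m_assoc base_inv act_mult valid_act)
  also have "act (inv\<^bsub>H\<^esub> stab) ?s = Step \<one> False ?s"
    using s by (rule act_stable_inv_push)
  finally have "act (inv\<^bsub>H\<^esub> x) s = act (inv\<^bsub>H\<^esub> y) (Step \<one> False ?s)" .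
  moreover have "valid (Step \<one> False ?s)"
    using valid_act[of "inv\<^bsub>H\<^esub> stab" ?s] act_stable_inv_push[OF s] s by simp
  ultimately show ?case
    using Suc.IH[OF py(2), of "Step \<one> False ?s"] s(2) by (simp del: valid.simps)
qed

lemma signs_stable_act:
  "sorted_wrt (\<ge>) (signs s) \<Longrightarrow> sorted_wrt (\<ge>) (signs (stable_act True s))"
  by (auto simp: stable_act_def starts_def)

text \<open>As \<open>False < True\<close>, a weakly decreasing list of signs is a block of letters
  t followed by a block of inverse letters. Multiplying by t prepends t or deletes a leading inverse
  letter, and both keep this shape.\<close>

lemma signs_level_sorted:
  "x \<in> level n \<Longrightarrow> valid s \<Longrightarrow> sorted_wrt (\<ge>) (signs s) \<Longrightarrow> sorted_wrt (\<ge>) (signs (act x s))"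
proof (induction n arbitrary: x)
  case 0
  then show ?case by (auto simp: signs_act_base cone_carrier)
next
  case (Suc n)
  then obtain p y where py: "p \<in> P" "y \<in> level n" "x = base p \<cdot> (stab \<cdot> y)"
    by auto
  then have c: "p \<in> carrier G" "y \<in> carrier H" by (auto simp: cone_carrier level_carrier)
  have "act x s = base_act p (stable_act True (act y s))"
    using c py Suc.prems by (simp add: act_mult act_base act_stable valid_act valid_stable_act)
  then show ?case
    using signs_stable_act[OF Suc.IH[OF py(2) Suc.prems(2,3)]] by (simp only: signs_base_act)
qed

lemma signs_nf_inv:
  assumes "q \<in> level m"
  shows "True \<notin> set (signs (nf (inv\<^bsub>H\<^esub> q)))"
  using signs_inv_level[OF assms] by simp

lemma signs_nf_quotient:
  assumes "p \<in> level k" "q \<in> level m"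
  shows "sorted_wrt (\<ge>) (signs (nf (p \<cdot> inv\<^bsub>H\<^esub> q)))"
proof -
  have "sorted_wrt (\<ge>) l" if "True \<notin> set l" for l
    using that by (induction l) auto
  then have "sorted_wrt (\<ge>) (signs (nf (inv\<^bsub>H\<^esub> q)))"
    using signs_nf_inv[OF assms(2)] by blast
  then show ?thesis
    using signs_level_sorted[OF assms(1)] assms
    by (simp add: act_mult level_carrier valid_act)
qed

lemma nf_base: "g \<in> carrier G \<Longrightarrow> nf (base g) = End g"
  by (simp add: act_base)

lemma base_inj:
  assumes "g \<in> carrier G" "h \<in> carrier G" "base g = base h"
  shows "g = h"
proof -
  have "End g = nf (base h)"
    using nf_base[OF assms(1), symmetric] unfolding assms(3) .
  also have "\<dots> = End h"
    by (rule nf_base[OF assms(2)])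
  finally show ?thesis by simp
qed

text \<open>The normal form of the identity has no stable letter, so \<open>x\<close> and its
  inverse both have level 0, and pointedness of \<open>P\<close> decides.\<close>

lemma cone_H_pointed:
  assumes "x \<in> cone" "inv\<^bsub>H\<^esub> x \<in> cone"
  shows "x = \<one>\<^bsub>H\<^esub>"
proof -
  obtain m n where mn: "x \<in> level m" "inv\<^bsub>H\<^esub> x \<in> level n"
    using assms cone_iff_level by blast
  then have x: "x \<in> carrier H" by (simp add: level_carrier)
  have "\<one>\<^bsub>H\<^esub> \<in> level (m + n)"
    using level_mult[OF mn] x by (simp only: H.r_inv)
  from signs_nf_level[OF this] have "m = 0" "n = 0"
    by (simp_all add: act_one)
  with mn obtain p q where p: "p \<in> P" "x = base p" and q: "q \<in> P" "inv\<^bsub>H\<^esub> x = base q"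
    by auto
  have "base (inv p) = base q"
    using p q base_inv[of p] cone_carrier[of p] by metis
  then have "inv p = q"
    using p(1) q(1) by (intro base_inj) (auto simp: cone_carrier)
  then have "p = \<one>"
    using p(1) q(1) cone_inv[of p] by simp
  then show ?thesis using p(2) base_one by simp
qed

section \<open>Prefixes and cancellation in quotients of cone elements\<close>

lemma side_lub:
  assumes b: "b \<in> B" and v: "v \<in> P" "inv b \<otimes> v \<in> P"
  obtains c where "c \<in> B" "c \<in> P" "inv b \<otimes> c \<in> B" "inv b \<otimes> c \<in> P"
    "\<And>w. w \<in> P \<Longrightarrow> inv b \<otimes> w \<in> P \<Longrightarrow> inv c \<otimes> w \<in> P"
proof -
  have bG: "b \<in> carrier G"
    by (rule subgroup.mem_carrier[OF B b])
  have one: "\<one> \<in> B"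
    by (rule subgroup.one_closed[OF B])
  \<comment> \<open>Closure of \<open>B\<close> under joins keeps this element in \<open>B\<close>,
    and it writes \<open>b\<close> as a quotient of two elements of
    \<open>B \<inter> P\<close>.\<close>
  let ?c = "join G P \<one> b"
  have ub: "upper_bound_in G P {\<one>, b} w \<longleftrightarrow> w \<in> P \<and> inv b \<otimes> w \<in> P" for w
    by (auto simp: upper_bound_in_def cone_le_def cone_carrier)
  have fin: "join_finite G P \<one> b"
    using v ub by (auto simp: join_finite_def)
  have cB: "?c \<in> B" by (rule join_closed[OF one b fin])
  have lub: "lub_in G P {\<one>, b} ?c"
    using join_is_lub[OF _ bG fin] by simp
  then have "?c \<in> P" "inv b \<otimes> ?c \<in> P"
    using ub by (auto simp: lub_in_def)
  moreover have "inv ?c \<otimes> w \<in> P" if "w \<in> P" "inv b \<otimes> w \<in> P" for w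
    using lub ub[of w] that by (auto simp: lub_in_def cone_le_def)
  moreover have "inv b \<otimes> ?c \<in> B"
    using subgroup.m_closed[OF B subgroup.m_inv_closed[OF B b] cB] .
  ultimately show ?thesis using that cB by blast
qed

text \<open>An initial t of the normal form is the first t of \<open>p\<close>, uncancelled, so
  \<open>y\<close> is the minimal representative of the first syllable of \<open>p\<close>, and the
  positive remainder crosses t. Only the normal form of the quotient enters, so all quotients equal
  to the same element have numerators with this prefix.\<close>

lemma quotient_prefix:
  assumes p: "p \<in> level k" and q: "q \<in> level m"
    and nf: "nf (p \<cdot> inv\<^bsub>H\<^esub> q) = Step y True s"
  shows "\<exists>j p'. k = Suc j \<and> p' \<in> level j \<and> y \<in> P \<and> p = base y \<cdot> (stab \<cdot> p')"
proof (cases k)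
  case 0
  then obtain p0 where p0: "p0 \<in> P" "p = base p0" using p by auto
  then have "signs (nf (inv\<^bsub>H\<^esub> q)) = signs (nf (p \<cdot> inv\<^bsub>H\<^esub> q))"
    using level_carrier[OF q] by (simp add: act_mult act_base valid_act cone_carrier)
  also have "\<dots> = True # signs s" by (simp add: nf)
  finally show ?thesis using signs_nf_inv[OF q] by simp
next
  case (Suc j)
  then obtain z p1 where z: "z \<in> P" and p1: "p1 \<in> level j" and pz: "p = base z \<cdot> (stab \<cdot> p1)"
    using p by auto
  have c: "z \<in> carrier G" "p1 \<in> carrier H" "q \<in> carrier H"
    using z p1 q by (auto simp: cone_carrier level_carrier)
  define r where "r = nf (p1 \<cdot> inv\<^bsub>H\<^esub> q)"
  have r: "valid r" using c by (simp add: r_def valid_act)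
  have nf_r: "nf (p \<cdot> inv\<^bsub>H\<^esub> q) = base_act z (stable_act True r)"
    using c r by (simp add: pz r_def H.m_assoc act_mult act_base act_stable valid_act valid_stable_act)
  \<comment> \<open>If t cancelled, \<open>r\<close> would begin with an inverse letter and, its
    signs being sorted, have no t after it, against the initial t of the product.\<close>
  have "\<not> starts False r"
  proof
    assume "starts False r"
    then obtain r' where r': "r = Step \<one> False r'" by (auto simp: starts_def)
    have "sorted_wrt (\<ge>) (signs r)"
      unfolding r_def by (rule signs_nf_quotient[OF p1 q])
    then have "True \<notin> set (signs r')" by (auto simp: r')
    moreover have "signs r' = signs (nf (p \<cdot> inv\<^bsub>H\<^esub> q))"
      using stable_act_cancel[of True r'] by (simp add: nf_r r')
    ultimately show False using nf by simp
  qed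
  then have y: "y = rep True z"
    using nf c by (simp add: nf_r stable_act_push)
  define b where "b = \<phi> (inv y \<otimes> z)"
  have a: "inv y \<otimes> z \<in> side True" "inv y \<otimes> z \<in> P" and yP: "y \<in> P"
    using rep_diff[OF c(1), of True] rep_cone[OF z] by (simp_all add: y)
  have b: "b \<in> B" "b \<in> P" "side_map False b = inv y \<otimes> z"
    using side_map_closed[OF a(1)] side_map_cone[OF a] side_map_side_map[OF a(1)]
    by (simp_all add: side_map_def side_def b_def)
  have "p = base y \<cdot> (base (side_map False b) \<cdot> (stab \<cdot> p1))"
    using c yP by (simp add: pz b(3) base_mult_left cone_carrier mult_inv_mult)
  also have "\<dots> = base y \<cdot> (stab \<cdot> (base b \<cdot> p1))"
    using c by (simp only: base_stable[OF b(1)])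
  finally show ?thesis
    using Suc yP level_base_mult[OF b(2) p1] by blast
qed

text \<open>
  The stable letter can only cancel if the innermost syllable lies in \<open>B\<close>; its least upper bound
  with \<open>\<one>\<close>, which is in \<open>B\<close> again, splits it into a quotient of elements of \<open>B \<inter> P\<close>.
\<close>

lemma quotient_cancel:
  assumes "p \<in> level k" "q \<in> level m" "starts False (nf (p \<cdot> inv\<^bsub>H\<^esub> q))"
  shows "\<exists>k' m' p' q'. p' \<in> level k' \<and> q' \<in> level m' \<and> k' + m' < Suc (k + m) \<and>
    stab \<cdot> (p \<cdot> inv\<^bsub>H\<^esub> q) = p' \<cdot> inv\<^bsub>H\<^esub> q'"
  using assms
proof (induction k arbitrary: p)
  case 0
  then obtain p0 where p0: "p0 \<in> P" "p = base p0" by auto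
  then have p0G: "p0 \<in> carrier G" by (simp add: cone_carrier)
  have "m \<noteq> 0"
  proof
    assume "m = 0"
    then obtain q0 where "q0 \<in> P" "q = base q0" using 0 by auto
    then have "p \<cdot> inv\<^bsub>H\<^esub> q = base (p0 \<otimes> inv q0)"
      using p0 by (simp add: base_inv base_mult cone_carrier)
    then show False
      using 0 p0G cone_carrier[OF \<open>q0 \<in> P\<close>] by (simp add: nf_base starts_def)
  qed
  then obtain n where n: "m = Suc n" by (cases m) auto
  obtain q1 q0 where q: "q1 \<in> level n" "q0 \<in> P" "q = q1 \<cdot> (stab \<cdot> base q0)"
    using level_snoc[of q n] 0(2) n by blast
  have c: "q1 \<in> carrier H" "q0 \<in> carrier G"
    using q by (auto simp: level_carrier cone_carrier)
  define b where "b = p0 \<otimes> inv q0"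
  have bG: "b \<in> carrier G" using c p0G by (simp add: b_def)
  have pq: "p \<cdot> inv\<^bsub>H\<^esub> q = base b \<cdot> (inv\<^bsub>H\<^esub> stab \<cdot> inv\<^bsub>H\<^esub> q1)"
    using c p0G by (simp add: q p0 b_def H.inv_mult_group H.m_assoc base_inv base_mult_left)
  have "nf (p \<cdot> inv\<^bsub>H\<^esub> q) = base_act b (act (inv\<^bsub>H\<^esub> stab) (nf (inv\<^bsub>H\<^esub> q1)))"
    using c bG by (simp add: pq act_mult act_base valid_act)
  also have "act (inv\<^bsub>H\<^esub> stab) (nf (inv\<^bsub>H\<^esub> q1)) = Step \<one> False (nf (inv\<^bsub>H\<^esub> q1))"
    using c by (intro act_stable_inv_push signs_nf_inv[OF q(1)]) (simp add: valid_act)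
  finally have "starts False (base_act b (Step \<one> False (nf (inv\<^bsub>H\<^esub> q1))))"
    using 0(3) by simp
  then have "rep False b = \<one>"
    using bG by (simp add: starts_def)
  then have b: "b \<in> B"
    using bG rep_eq_one_iff[of b False] by (simp add: side_def)
  \<comment> \<open>This element is \<open>q0\<close>, so \<open>p0\<close> is a common upper bound
    of \<open>\<one>\<close> and \<open>b\<close>.\<close>
  have "inv b \<otimes> p0 \<in> P"
    using c p0G q by (simp add: b_def inv_mult_group m_assoc)
  then obtain d where d: "d \<in> B" "d \<in> P" "inv b \<otimes> d \<in> B" "inv b \<otimes> d \<in> P"
    using side_lub[OF b p0(1)] by blast
  let ?x = "side_map False b" and ?y = "side_map False d" and ?z = "side_map False (inv b \<otimes> d)"
  have yz: "?y \<in> P" "?z \<in> P"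
    using d by (auto simp: side_def intro!: side_map_cone)
  have xG: "?x \<in> carrier G" "?y \<in> carrier G" "?z \<in> carrier G"
    using b d by (auto simp: side_def intro!: psi_carrier)
  have "?y = ?x \<otimes> ?z"
    using side_map_mult[of b False "inv b \<otimes> d"] b d bG cone_carrier[OF d(2)]
    by (simp add: side_def mult_inv_mult)
  then have x: "?x = ?y \<otimes> inv ?z"
    using xG by (simp add: m_assoc)
  have "stab \<cdot> (p \<cdot> inv\<^bsub>H\<^esub> q) = base ?x \<cdot> (stab \<cdot> (inv\<^bsub>H\<^esub> stab \<cdot> inv\<^bsub>H\<^esub> q1))"
    using b c by (simp add: pq base_stable)
  also have "\<dots> = base ?x \<cdot> inv\<^bsub>H\<^esub> q1"
    using c by (simp add: H.mult_inv_mult)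
  also have "\<dots> = base ?y \<cdot> inv\<^bsub>H\<^esub> (q1 \<cdot> base ?z)"
    using c xG by (simp add: x H.inv_mult_group base_inv base_mult_left)
  finally have "stab \<cdot> (p \<cdot> inv\<^bsub>H\<^esub> q) = base ?y \<cdot> inv\<^bsub>H\<^esub> (q1 \<cdot> base ?z)" .
  moreover have "base ?y \<in> level 0" "q1 \<cdot> base ?z \<in> level n"
    using yz level_mult[OF q(1), of "base ?z" 0] by auto
  moreover have "0 + n < Suc (0 + m)" using n by simp
  ultimately show ?case by blast
next
  case (Suc k)
  then obtain z p1 where z: "z \<in> P" and p1: "p1 \<in> level k" and pz: "p = base z \<cdot> (stab \<cdot> p1)"
    by auto
  have c: "z \<in> carrier G" "p1 \<in> carrier H" "q \<in> carrier H"
    using z p1 Suc.prems(2) by (auto simp: cone_carrier level_carrier)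
  define r where "r = nf (p1 \<cdot> inv\<^bsub>H\<^esub> q)"
  have r: "valid r" using c by (simp add: r_def valid_act)
  have nf_r: "nf (p \<cdot> inv\<^bsub>H\<^esub> q) = base_act z (stable_act True r)"
    using c r by (simp add: pz r_def H.m_assoc act_mult act_base act_stable valid_act valid_stable_act)
  \<comment> \<open>Otherwise the first t of \<open>p\<close> would survive and lead the normal
    form. So it cancels already against the quotient of \<open>p1\<close>, to which the induction
    hypothesis applies.\<close>
  have "starts False r"
  proof (rule ccontr)
    assume "\<not> starts False r"
    then show False
      using Suc.prems(3) by (simp add: nf_r stable_act_push starts_def)
  qed
  then obtain k' m' p' q' where IH: "p' \<in> level k'" "q' \<in> level m'" "k' + m' < Suc (k + m)"
    "stab \<cdot> (p1 \<cdot> inv\<^bsub>H\<^esub> q) = p' \<cdot> inv\<^bsub>H\<^esub> q'"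
    using Suc.IH[OF p1 Suc.prems(2)] unfolding r_def by blast
  have c': "p' \<in> carrier H" "q' \<in> carrier H"
    using IH by (auto simp: level_carrier)
  have "stab \<cdot> (p \<cdot> inv\<^bsub>H\<^esub> q) = stab \<cdot> (base z \<cdot> (stab \<cdot> (p1 \<cdot> inv\<^bsub>H\<^esub> q)))"
    using c by (simp add: pz H.m_assoc)
  also have "\<dots> = stab \<cdot> (base z \<cdot> p') \<cdot> inv\<^bsub>H\<^esub> q'"
    using c c' by (simp add: IH(4) H.m_assoc)
  finally show ?case
    using IH(2,3) level_stab_mult[OF level_base_mult[OF z IH(1)]]
    by (intro exI[of _ "Suc k'"] exI[of _ m'] exI[of _ "stab \<cdot> (base z \<cdot> p')"] exI[of _ q']) simp
qed

text \<open>Induction on the number of stable letters. The normal forms of \<open>p\<close> and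
  \<open>base g \<cdot> q\<close> have first syllables in the same coset of \<open>A\<close>; their
  difference crosses t to some \<open>b\<close> in \<open>B\<close>, which relates the remaining
  factors \<open>p1\<close> and \<open>q1\<close> as \<open>g\<close> relates \<open>p\<close> and
  \<open>q\<close>.\<close>

lemma base_quotient_bound:
  assumes "p \<in> level k" "q \<in> level m" "g \<in> carrier G" "p = base g \<cdot> q"
  shows "\<exists>v\<in>P. inv g \<otimes> v \<in> P \<and> (\<exists>r\<in>cone. p = base v \<cdot> r)"
  using assms
proof (induction k arbitrary: p q m g)
  case 0
  then have "signs (nf p) = signs (nf q)"
    by (simp add: act_mult act_base level_carrier valid_act)
  then have "m = 0"
    using signs_nf_level[OF 0(1)] signs_nf_level[OF 0(2)] by simp
  with 0 obtain p0 q0 where p0: "p0 \<in> P" "p = base p0" and q0: "q0 \<in> P" "q = base q0"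
    by auto
  then have "base p0 = base (g \<otimes> q0)"
    using 0 by (simp add: base_mult cone_carrier)
  then have "p0 = g \<otimes> q0"
    using p0(1) q0(1) 0(3) by (intro base_inj) (auto simp: cone_carrier)
  then have "inv g \<otimes> p0 \<in> P"
    using q0 0(3) by (simp add: mult_inv_mult cone_carrier)
  moreover have "p = base p0 \<cdot> base \<one>"
    using p0 by (simp add: base_one cone_carrier)
  ultimately show ?case
    using p0(1) base_mem_cone[OF cone_one] by blast
next
  case (Suc k)
  have qH: "q \<in> carrier H" using Suc.prems(2) by (rule level_carrier)
  have nfpq: "nf p = base_act g (nf q)"
    using Suc.prems(3,4) qH by (simp add: act_mult act_base valid_act)
  then have "signs (nf p) = signs (nf q)" by simp
  then have "m = Suc k"
    using signs_nf_level[OF Suc.prems(1)] signs_nf_level[OF Suc.prems(2)]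
    by (metis length_replicate)
  then obtain z p1 w q1 where z: "z \<in> P" "p1 \<in> level k" "p = base z \<cdot> (stab \<cdot> p1)"
    and w: "w \<in> P" "q1 \<in> level k" "q = base w \<cdot> (stab \<cdot> q1)"
    using Suc.prems by auto
  have c: "z \<in> carrier G" "w \<in> carrier G" "p1 \<in> carrier H" "q1 \<in> carrier H"
    using z w by (auto simp: level_carrier cone_carrier)
  have nf_step: "\<exists>s. nf (base x \<cdot> (stab \<cdot> y)) = Step (rep True x) True s"
    if "y \<in> level k" "x \<in> carrier G" for x y
  proof -
    have "False \<notin> set (signs (nf y))"
      using signs_nf_level[OF that(1)] by simp
    then have "\<not> starts False (nf y)"
      by (auto simp: starts_def)
    then show ?thesis
      using that level_carrier[OF that(1)] valid_stable_act[of "nf y" True]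
      by (simp add: act_mult act_base act_stable valid_act stable_act_push)
  qed
  obtain s s' where "nf p = Step (rep True z) True s" "nf q = Step (rep True w) True s'"
    using nf_step z w c by metis
  then have "rep True z = rep True (g \<otimes> w)"
    using nfpq rep_mult_rep[OF c(2) Suc.prems(3), of True] by simp
  then have "inv z \<otimes> (g \<otimes> w) \<in> side True"
    using c Suc.prems(3) by (intro rep_eqD) auto
  define b where "b = \<phi> (inv z \<otimes> (g \<otimes> w))"
  have b: "b \<in> B" "side_map False b = inv z \<otimes> (g \<otimes> w)"
    using side_map_closed[OF \<open>_ \<in> side True\<close>] side_map_side_map[OF \<open>_ \<in> side True\<close>]
    by (simp_all add: side_map_def side_def b_def)
  have bG: "b \<in> carrier G" using subgroup.mem_carrier[OF B b(1)] .
  have "base z \<cdot> (stab \<cdot> p1) = base z \<cdot> (base (side_map False b) \<cdot> (stab \<cdot> q1))"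
    using z(3) w(3) Suc.prems(3,4) c by (simp add: b(2) base_mult_left mult_inv_mult)
  also have "\<dots> = base z \<cdot> (stab \<cdot> (base b \<cdot> q1))"
    using c by (simp only: base_stable[OF b(1)])
  finally have p1: "p1 = base b \<cdot> q1"
    using c bG by simp
  obtain v r where v: "v \<in> P" "inv b \<otimes> v \<in> P" and r: "r \<in> cone" "p1 = base v \<cdot> r"
    using Suc.IH[OF z(2) w(2) bG p1] by blast
  \<comment> \<open>The join \<open>d\<close> of \<open>\<one>\<close> and \<open>b\<close> lies
    below \<open>v\<close> and in \<open>B\<close>, so it can be carried back across the stable
    letter.\<close>
  obtain d where d: "d \<in> B" "d \<in> P" "inv b \<otimes> d \<in> B" "inv b \<otimes> d \<in> P" "inv d \<otimes> v \<in> P"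
    using side_lub[OF b(1) v] v by blast
  have dv: "d \<in> carrier G" "v \<in> carrier G" "r \<in> carrier H"
    using d v r cone_H_carrier by (auto simp: cone_carrier)
  let ?y = "side_map False d" and ?x = "side_map False (inv b \<otimes> d)"
  have xy: "?y \<in> P" "?x \<in> P"
    using d by (auto simp: side_def intro!: side_map_cone)
  then have xyG: "?y \<in> carrier G" "?x \<in> carrier G" by (auto simp: cone_carrier)
  have "?y = side_map False b \<otimes> ?x"
    using side_map_mult[of b False "inv b \<otimes> d"] b d bG dv
    by (simp add: side_def mult_inv_mult)
  \<comment> \<open>The witness \<open>z \<otimes> ?y\<close> equals
    \<open>g \<otimes> (w \<otimes> ?x)\<close>, hence lies above \<open>g\<close>.\<close>
  then have "inv g \<otimes> (z \<otimes> ?y) = w \<otimes> ?x"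
    using c xyG Suc.prems(3) by (simp add: b(2) m_assoc mult_inv_mult)
  then have "inv g \<otimes> (z \<otimes> ?y) \<in> P"
    using cone_closed[OF w(1) xy(2)] by simp
  moreover have "p = base (z \<otimes> ?y) \<cdot> (stab \<cdot> (base (inv d \<otimes> v) \<cdot> r))"
  proof -
    have "p = base z \<cdot> (stab \<cdot> (base d \<cdot> (base (inv d \<otimes> v) \<cdot> r)))"
      using z(3) r(2) dv by (simp add: base_mult_left mult_inv_mult)
    also have "\<dots> = base z \<cdot> (base ?y \<cdot> (stab \<cdot> (base (inv d \<otimes> v) \<cdot> r)))"
      using d dv by (simp add: base_stable)
    finally show ?thesis using c xyG dv by (simp add: base_mult_left)
  qed
  moreover have "stab \<cdot> (base (inv d \<otimes> v) \<cdot> r) \<in> cone"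
    using cone_H_mult stab_mem_cone base_mem_cone[OF d(5)] r(1) by blast
  ultimately show ?case
    using cone_closed[OF z(1) xy(1)] by blast
qed

section \<open>Existence of least upper bounds\<close>

lemma base_lub:
  assumes g: "g \<in> carrier G" and v: "v \<in> P" "inv g \<otimes> v \<in> P"
  shows "\<exists>u. lub_in H cone {base g} u"
proof -
  have "upper_bound_in G P {g} v"
    using v by (simp add: upper_bound_in_def cone_le_def)
  then obtain u where u: "lub_in G P {g} u"
    using lub_exists[of "{g}"] g by blast
  then have uP: "u \<in> P" "inv g \<otimes> u \<in> P"
    and least: "\<And>w. w \<in> P \<Longrightarrow> inv g \<otimes> w \<in> P \<Longrightarrow> inv u \<otimes> w \<in> P"
    by (auto simp: lub_in_singleton_iff)
  have uG: "u \<in> carrier G" using uP cone_carrier by blast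
  \<comment> \<open>By \<open>base_quotient_bound\<close>, \<open>p\<close> lies above some upper
    bound \<open>w\<close> of \<open>g\<close> in \<open>P\<close>, and \<open>u\<close> lies below
    \<open>w\<close>.\<close>
  have "inv\<^bsub>H\<^esub> (base u) \<cdot> p \<in> cone" if p: "p \<in> cone" "inv\<^bsub>H\<^esub> (base g) \<cdot> p \<in> cone" for p
  proof -
    obtain k m where km: "p \<in> level k" "inv\<^bsub>H\<^esub> (base g) \<cdot> p \<in> level m"
      using p cone_iff_level by blast
    have "p = base g \<cdot> (inv\<^bsub>H\<^esub> (base g) \<cdot> p)"
      using km g by (simp add: H.mult_inv_mult level_carrier)
    then obtain w r where w: "w \<in> P" "inv g \<otimes> w \<in> P" "r \<in> cone" "p = base w \<cdot> r"
      using base_quotient_bound[OF km g] by blast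
    then have "inv\<^bsub>H\<^esub> (base u) \<cdot> p = base (inv u \<otimes> w) \<cdot> r"
      using uG cone_H_carrier by (simp add: base_inv base_mult_left cone_carrier subset_iff)
    then show ?thesis
      using cone_H_mult[OF base_mem_cone[OF least[OF w(1,2)]] w(3)] by simp
  qed
  then have "lub_in H cone {base g} (base u)"
    using uP uG g by (simp add: H.lub_in_singleton_iff base_mem_cone base_inv base_mult)
  then show ?thesis ..
qed

lemma quotient_lub:
  assumes "p \<in> level k" "q \<in> level m"
  shows "\<exists>u. lub_in H cone {p \<cdot> inv\<^bsub>H\<^esub> q} u"
  using assms
proof (induction "k + m" arbitrary: k m p q rule: less_induct)
  case less
  \<comment> \<open>The case of a numerator with a stable letter, for arbitrary \<open>p\<close> and
    \<open>q\<close> so that it also applies after the two are swapped.\<close>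
  have lub_Suc: "\<exists>u. lub_in H cone {p \<cdot> inv\<^bsub>H\<^esub> q} u"
    if p: "p \<in> level (Suc j)" and q: "q \<in> level n" and jn: "Suc j + n = k + m" for p q j n
  proof -
    obtain z p1 where z: "z \<in> P" and p1: "p1 \<in> level j" and pz: "p = base z \<cdot> (stab \<cdot> p1)"
      using p by auto
    have c: "z \<in> carrier G" "p1 \<in> carrier H" "q \<in> carrier H" "p \<in> carrier H"
      using z p1 q p by (auto simp: cone_carrier level_carrier simp del: level.simps)
    show ?thesis
    proof (cases "starts False (nf (p1 \<cdot> inv\<^bsub>H\<^esub> q))")
      case True
      then obtain k' m' p' q' where IH: "p' \<in> level k'" "q' \<in> level m'" "k' + m' < Suc (j + n)"
        "stab \<cdot> (p1 \<cdot> inv\<^bsub>H\<^esub> q) = p' \<cdot> inv\<^bsub>H\<^esub> q'"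
        using quotient_cancel[OF p1 q] by blast
      have "p \<cdot> inv\<^bsub>H\<^esub> q = base z \<cdot> (stab \<cdot> (p1 \<cdot> inv\<^bsub>H\<^esub> q))"
        using c by (simp add: pz H.m_assoc)
      also have "\<dots> = base z \<cdot> p' \<cdot> inv\<^bsub>H\<^esub> q'"
        using c level_carrier[OF IH(1)] level_carrier[OF IH(2)] by (simp add: IH(4) H.m_assoc)
      finally show ?thesis
        using less.hyps[OF _ level_base_mult[OF z IH(1)] IH(2)] IH(3) jn by simp
    next
      case False
      define y where "y = rep True z"
      have "nf (p \<cdot> inv\<^bsub>H\<^esub> q) = base_act z (stable_act True (nf (p1 \<cdot> inv\<^bsub>H\<^esub> q)))"
        using c
        by (simp add: pz H.m_assoc act_mult act_base act_stable valid_act valid_stable_act)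
      then obtain s where s: "nf (p \<cdot> inv\<^bsub>H\<^esub> q) = Step y True s"
        using False c by (simp add: stable_act_push y_def)
      then obtain p2 where p2: "p2 \<in> level j" and y: "y \<in> P" and pp2: "p = base y \<cdot> (stab \<cdot> p2)"
        using quotient_prefix[OF p q] by auto
      \<comment> \<open>The surviving prefix y t is split off, which leaves a quotient with one
        stable letter less.\<close>
      let ?c = "base y \<cdot> stab" and ?x = "p2 \<cdot> inv\<^bsub>H\<^esub> q"
      have p2H: "p2 \<in> carrier H" and yG: "y \<in> carrier G"
        using p2 y by (auto simp: level_carrier cone_carrier)
      have cx: "p \<cdot> inv\<^bsub>H\<^esub> q = ?c \<cdot> ?x"
        using c p2H yG by (simp add: pp2 H.m_assoc)
      obtain u where u: "lub_in H cone {?x} u"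
        using less.hyps[OF _ p2 q] jn by auto
      have "lub_in H cone {?c \<cdot> ?x} (?c \<cdot> u)"
      proof (rule H.lub_in_shift[OF cone_H_carrier cone_H_mult _ _ u])
        fix w assume w: "w \<in> cone" "inv\<^bsub>H\<^esub> (?c \<cdot> ?x) \<cdot> w \<in> cone"
        then obtain i l where il: "w \<in> level i" "inv\<^bsub>H\<^esub> (?c \<cdot> ?x) \<cdot> w \<in> level l"
          using cone_iff_level by blast
        \<comment> \<open>Each upper bound \<open>w\<close> is the numerator of another quotient
          equal to \<open>?c \<cdot> ?x\<close>, so it has the prefix \<open>?c\<close> by
          \<open>quotient_prefix\<close>.\<close>
        have "w \<cdot> inv\<^bsub>H\<^esub> (inv\<^bsub>H\<^esub> (?c \<cdot> ?x) \<cdot> w) = ?c \<cdot> ?x"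
          using level_carrier[OF il(1)] c p2H yG
          by (simp add: H.inv_mult_group H.m_assoc H.mult_inv_mult)
        then obtain w' where w': "w' \<in> cone" "w = base y \<cdot> (stab \<cdot> w')"
          using quotient_prefix[OF il, of y s] s cx cone_iff_level by auto
        then have "w' \<in> carrier H" using cone_H_carrier by blast
        then have "inv\<^bsub>H\<^esub> ?c \<cdot> w = w'"
          using yG w'(2) by (simp add: H.inv_mult_group H.m_assoc H.mult_inv_mult)
        then show "inv\<^bsub>H\<^esub> ?c \<cdot> w \<in> cone" using w' by simp
      qed (use c p2H in \<open>auto intro: cone_H_mult base_mem_cone[OF y] stab_mem_cone\<close>)
      then show ?thesis using cx by auto
    qed
  qed
  show ?case
  proof (cases k)
    case (Suc j)
    then show ?thesis using lub_Suc[of p j q m] less.prems by simp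
  next
    case k: 0
    then obtain p0 where p0: "p0 \<in> P" "p = base p0" using less.prems by auto
    show ?thesis
    proof (cases m)
      case 0
      then obtain q0 where q0: "q0 \<in> P" "q = base q0" using less.prems by auto
      have c: "p0 \<in> carrier G" "q0 \<in> carrier G" using p0 q0 by (auto simp: cone_carrier)
      have "\<exists>u. lub_in H cone {base (p0 \<otimes> inv q0)} u"
        using c p0 q0 by (intro base_lub[of _ p0]) (auto simp: inv_mult_group m_assoc)
      then show ?thesis using c by (simp add: p0(2) q0(2) base_inv base_mult)
    next
      case (Suc j)
      \<comment> \<open>Inverting the quotient swaps \<open>p\<close> and \<open>q\<close> and so
        puts a stable letter into the numerator.\<close>
      have c: "p \<in> carrier H" "q \<in> carrier H" using less.prems by (auto simp: level_carrier)
      obtain u where "lub_in H cone {q \<cdot> inv\<^bsub>H\<^esub> p} u"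
        using lub_Suc[of q j p 0] less.prems Suc k by (auto simp del: level.simps)
      then have "lub_in H cone {inv\<^bsub>H\<^esub> (p \<cdot> inv\<^bsub>H\<^esub> q)} u"
        using c by (simp add: H.inv_mult_group)
      then show ?thesis
        using H.lub_in_inv[OF _ cone_H_carrier, of "p \<cdot> inv\<^bsub>H\<^esub> q"] c by blast
    qed
  qed
qed

lemma quasi_lattice_ordered_HNN: "quasi_lattice_ordered H cone"
proof (rule quasi_lattice_orderedI)
  show "\<one>\<^bsub>H\<^esub> \<in> cone"
    using base_mem_cone[OF cone_one] by (simp add: base_one)
next
  fix x u assume x: "x \<in> carrier H" and "upper_bound_in H cone {x} u"
  then have u: "u \<in> cone" "inv\<^bsub>H\<^esub> x \<cdot> u \<in> cone"
    by (auto simp: upper_bound_in_def cone_le_def)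
  then obtain k m where km: "u \<in> level k" "inv\<^bsub>H\<^esub> x \<cdot> u \<in> level m"
    using cone_iff_level by blast
  \<comment> \<open>An upper bound exhibits \<open>x\<close> as a quotient of cone elements, as
    \<open>quotient_lub\<close> requires.\<close>
  have "u \<cdot> inv\<^bsub>H\<^esub> (inv\<^bsub>H\<^esub> x \<cdot> u) = x"
    using x level_carrier[OF km(1)] by (simp add: H.inv_mult_group H.mult_inv_mult)
  then show "\<exists>u. lub_in H cone {x} u"
    using quotient_lub[OF km] by simp
qed (simp_all add: group_HNN cone_H_carrier cone_H_mult cone_H_pointed)

end

theorem theorem4p1:
  fixes G :: "('a, 'm) monoid_scheme" and P A B :: "'a set" and \<phi> :: "'a \<Rightarrow> 'a"
  assumes qlo: "quasi_lattice_ordered G P"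
    and A: "subgroup A G" and B: "subgroup B G"
    and phi_iso: "\<phi> \<in> iso (G\<lparr>carrier := A\<rparr>) (G\<lparr>carrier := B\<rparr>)"
    and phi_cone: "\<phi> ` (A \<inter> P) = B \<inter> P"
    and min_rep: "\<And>g. \<lbrakk>g \<in> carrier G; (g <#\<^bsub>G\<^esub> A) \<inter> P \<noteq> {}\<rbrakk> \<Longrightarrow>
      \<exists>p \<in> (g <#\<^bsub>G\<^esub> A) \<inter> P. \<forall>q \<in> (g <#\<^bsub>G\<^esub> A) \<inter> P. cone_le G P p q"
    and join_closed: "\<And>x y. \<lbrakk>x \<in> B; y \<in> B; join_finite G P x y\<rbrakk> \<Longrightarrow> join G P x y \<in> B"
  shows "quasi_lattice_ordered (HNN G A \<phi>)
    (generated_subsemigroup (HNN G A \<phi>) (hnn_base G A \<phi> ` P \<union> {hnn_stable G A \<phi>}))"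
proof -
  interpret hnn_quasi_lattice G P A B \<phi>
    using assms by (intro hnn_quasi_lattice.intro hnn_quasi_lattice_axioms.intro)
  show ?thesis
    using quasi_lattice_ordered_HNN unfolding cone_def .
qed

end
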